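(* Let $d\ge2$, $0<\alpha\le\beta<\infty$, and let $A\in L^\infty(\mathbb R^d,\mathcal M_{\alpha\beta})$ be $Q$-periodic, not necessarily symmetric, with $Q=(-1,1)^d$, and let $A_{\mathrm{hom}}$ be the homogenized matrix. Let $\xi,\xi'\in\mathbb R^d$ be unit vectors and $\phi,\phi'\in H^1_{\mathrm{per}}(Q)$ the periodic corrector and dual corrector in directions $\xi,\xi'$. For $T>0$, $k\in\mathbb N$ let $\phi_{T,k},\phi'_{T,k}$ be the Richardson extrapolations of the regularized correctors and $A_{T,k}$ the associated approximation of the homogenized matrix. Then $$\|\nabla(\phi_{T,k}-\phi)\|_{L^2(Q)}+\|\nabla(\phi'_{T,k}-\phi')\|_{L^2(Q)}\lesssim T^{-k},\qquad |A_{\mathrm{hom}}-A_{T,k}|\lesssim T^{-2k},$$ where the multiplicative constants depend on $k,\alpha,\beta,d$.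
   Context: $\mathcal M_{\alpha\beta}$: real $d\times d$ matrices $M$ with $\xi\cdot M\xi\ge\alpha|\xi|^2$, $|M\xi|\le\beta|\xi|$; $A^*$ is the transpose. $H^1_{\mathrm{per}}(Q)$ is the closure in $H^1(Q)$ of smooth $Q$-periodic functions with zero mean. The corrector $\phi\in H^1_{\mathrm{per}}(Q)$ solves $-\nabla\cdot A(\xi+\nabla\phi)=0$, the dual corrector $\phi'\in H^1_{\mathrm{per}}(Q)$ solves $-\nabla\cdot A^*(\xi'+\nabla\phi')=0$, and $\xi'\cdot A_{\mathrm{hom}}\xi=\fint_Q(\xi'+\nabla\phi')\cdot A(\xi+\nabla\phi)$. For $T>0$, $\phi_T$ (resp. $\phi'_T$) is the periodic solution of $T^{-1}\phi_T-\nabla\cdot A(\xi+\nabla\phi_T)=0$ (resp. $T^{-1}\phi'_T-\nabla\cdot A^*(\xi'+\nabla\phi'_T)=0$) in $\mathbb R^d$. Richardson extrapolation: $\phi_{T,1}=\phi_T$, $\phi_{T,k+1}=\frac{1}{2^k-1}(2^k\phi_{2T,k}-\phi_{T,k})$, same for $\phi'$. $\xi'\cdot A_{T,k}\xi:=\fint_Q(\xi'+\nabla\phi'_{T,k})\cdot A(\xi+\nabla\phi_{T,k})$. *)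

theory Defs
  imports "HOL-Analysis.Analysis"
begin

coinductive smooth_fun :: "(real^'n \<Rightarrow> real) \<Rightarrow> bool" where
  "(\<forall>x. f differentiable (at x)) \<Longrightarrow>
   (\<forall>i. smooth_fun (\<lambda>x. frechet_derivative f (at x) (axis i 1))) \<Longrightarrow> smooth_fun f"

definition grad :: "(real^'n \<Rightarrow> real) \<Rightarrow> real^'n \<Rightarrow> real^'n" where
  "grad f x = (\<chi> i. frechet_derivative f (at x) (axis i 1))"

definition cubeQ :: "(real^'n) set" where
  "cubeQ = box (- One) One"

definition Qperiodic :: "(real^'n \<Rightarrow> 'a) \<Rightarrow> bool" where
  "Qperiodic f \<longleftrightarrow> (\<forall>x i. f (x + 2 *\<^sub>R axis i 1) = f x)"

definition test_fun :: "(real^'n \<Rightarrow> real) \<Rightarrow> bool" where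
  "test_fun \<psi> \<longleftrightarrow> smooth_fun \<psi> \<and> bounded {x. \<psi> x \<noteq> 0}"

definition M_ab :: "real \<Rightarrow> real \<Rightarrow> (real^'n^'n) set" where
  "M_ab \<alpha> \<beta> = {M. \<forall>\<xi>. \<xi> \<bullet> (M *v \<xi>) \<ge> \<alpha> * (norm \<xi>)\<^sup>2 \<and> norm (M *v \<xi>) \<le> \<beta> * norm \<xi>}"

definition coeff_field :: "real \<Rightarrow> real \<Rightarrow> (real^'n \<Rightarrow> real^'n^'n) \<Rightarrow> bool" where
  "coeff_field \<alpha> \<beta> A \<longleftrightarrow> A \<in> borel_measurable lborel \<and>
     (AE x in lborel. A x \<in> M_ab \<alpha> \<beta>) \<and> Qperiodic A"

text \<open>(u, g) lies in the H^1(Q)-closure of the smooth Q-periodic functions satisfying P: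
  u is (the periodic extension of) the limit and g its gradient.\<close>
definition H1_closure ::
  "((real^'n \<Rightarrow> real) \<Rightarrow> bool) \<Rightarrow> (real^'n \<Rightarrow> real) \<Rightarrow> (real^'n \<Rightarrow> real^'n) \<Rightarrow> bool" where
  "H1_closure P u g \<longleftrightarrow>
     u \<in> borel_measurable lborel \<and> g \<in> borel_measurable lborel \<and>
     Qperiodic u \<and> Qperiodic g \<and>
     (\<exists>v :: nat \<Rightarrow> real^'n \<Rightarrow> real.
        (\<forall>n. smooth_fun (v n) \<and> Qperiodic (v n) \<and> P (v n)) \<and>
        (\<lambda>n. \<integral>\<^sup>+ x \<in> cubeQ. ennreal ((v n x - u x)\<^sup>2) \<partial>lborel) \<longlonglongrightarrow> 0 \<and>
        (\<lambda>n. \<integral>\<^sup>+ x \<in> cubeQ. ennreal ((norm (grad (v n) x - g x))\<^sup>2) \<partial>lborel) \<longlonglongrightarrow> 0)"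

definition H1per :: "(real^'n \<Rightarrow> real) \<Rightarrow> (real^'n \<Rightarrow> real^'n) \<Rightarrow> bool" where
  "H1per = H1_closure (\<lambda>v. (LINT x:cubeQ|lborel. v x) = 0)"

definition H1per_loc :: "(real^'n \<Rightarrow> real) \<Rightarrow> (real^'n \<Rightarrow> real^'n) \<Rightarrow> bool" where
  "H1per_loc = H1_closure (\<lambda>v. True)"

text \<open>Weak form in R^d of  -div A(xi + grad phi) = 0  (g = grad phi).\<close>
definition corrector_eq ::
  "(real^'n \<Rightarrow> real^'n^'n) \<Rightarrow> real^'n \<Rightarrow> (real^'n \<Rightarrow> real^'n) \<Rightarrow> bool" where
  "corrector_eq A \<xi> g \<longleftrightarrow>
     (\<forall>\<psi>. test_fun \<psi> \<longrightarrow> (LINT x|lborel. grad \<psi> x \<bullet> (A x *v (\<xi> + g x))) = 0)"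

text \<open>Weak form in R^d of  T^{-1} u - div A(xi + grad u) = 0  (g = grad u).\<close>
definition reg_corrector_eq ::
  "(real^'n \<Rightarrow> real^'n^'n) \<Rightarrow> real^'n \<Rightarrow> real \<Rightarrow> (real^'n \<Rightarrow> real) \<Rightarrow> (real^'n \<Rightarrow> real^'n) \<Rightarrow> bool" where
  "reg_corrector_eq A \<xi> T u g \<longleftrightarrow>
     (\<forall>\<psi>. test_fun \<psi> \<longrightarrow>
        (LINT x|lborel. u x * \<psi> x / T + grad \<psi> x \<bullet> (A x *v (\<xi> + g x))) = 0)"

text \<open>Richardson extrapolation of a family F indexed by T:
  rich F 1 T = F T,  rich F (k+1) T = (2^k rich F k (2T) - rich F k T)/(2^k - 1).
  (The index 0 is a harmless convention, equal to index 1.)\<close>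
primrec rich :: "(real \<Rightarrow> 'x \<Rightarrow> 'a::real_vector) \<Rightarrow> nat \<Rightarrow> real \<Rightarrow> 'x \<Rightarrow> 'a" where
  "rich F 0 T x = F T x"
| "rich F (Suc k) T x =
     (if k = 0 then F T x
      else (1 / (2 ^ k - 1)) *\<^sub>R ((2 ^ k) *\<^sub>R rich F k (2 * T) x - rich F k T x))"

definition L2Q :: "(real^'n \<Rightarrow> real^'n) \<Rightarrow> real" where
  "L2Q h = sqrt (LINT x:cubeQ|lborel. (norm (h x))\<^sup>2)"

definition bilin_avg ::
  "(real^'n \<Rightarrow> real^'n^'n) \<Rightarrow> real^'n \<Rightarrow> (real^'n \<Rightarrow> real^'n) \<Rightarrow> real^'n \<Rightarrow> (real^'n \<Rightarrow> real^'n) \<Rightarrow> real" where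
  "bilin_avg A \<xi>' g' \<xi> g =
     (LINT x:cubeQ|lborel. (\<xi>' + g' x) \<bullet> (A x *v (\<xi> + g x))) / measure lborel (cubeQ :: (real^'n) set)"

end

theory Submission
  imports Defs "HOL-Computational_Algebra.Polynomial"
begin

text \<open>
  Write \<open>L = -div A grad\<close> on periodic functions of mean zero and \<open>u_S\<close> for the regularized corrector,
  so that \<open>L u_S + u_S / S = div (A \<xi>)\<close>. Unrolling the recursion, the extrapolation is a combination
  of the \<open>u_S\<close> with \<open>S = 2 ^ i * T\<close>, whose coefficients \<open>a i\<close> sum up to one and satisfy
  \<open>(\<Sum>i. a i / 2 ^ (i * j)) = 0\<close> for \<open>1 \<le> j < k\<close>. If coefficients \<open>b i\<close> sum up to zero, then \<open>\<xi>\<close>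
  disappears from the equation of the combination \<open>w\<close> of the \<open>u_S\<close>, and \<open>L w = - z / T\<close> with \<open>z\<close> the
  combination with coefficients \<open>b i / 2 ^ i\<close>. By coercivity and the Poincare inequality, every
  vanishing moment gains a factor \<open>1 / T\<close>, and no solvability theory for \<open>L\<close> is needed. The estimate
  for the homogenized matrix is quadratic in the errors \<open>e\<close>, \<open>e'\<close> of the gradients, since the two
  corrector equations cancel the terms that are linear in the errors.
\<close>

section \<open>Smooth functions and a periodic partition of unity\<close>

text \<open>The equations are given with compactly supported test functions on the whole space,
  whereas the energy arguments test with periodic functions: the solutions and the errors
  themselves. The partition of unity, the folding of integrals onto the cell and the density
  argument bridge this gap. Value and gradient are kept together as one square-integrable map into a
  product space, so that closure in H^1 becomes closure in L^2. The zero-order term carries the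
  weight 1 / S. At S = 2^i T, a coefficient b i therefore reappears as b i / (2^i T), which is where
  the moments come from. The Poincare inequality needs mean zero; for the regularized correctors
  this is derived from their equation. The count of powers is as follows. The L^2 bound that starts
  the iteration is uniform in S. The error equation gives T^-2 in the squared norm and leaves
  coefficients a i / 2^i with k - 1 vanishing moments, each worth another T^-2; together T^(-2k).
  The constants are uniform because the coefficients a i depend on k alone.\<close>

lemma smooth_fun_differentiable: "smooth_fun f \<Longrightarrow> f differentiable (at x)"
  by (erule smooth_fun.cases) blast

lemma smooth_fun_partial:
  "smooth_fun f \<Longrightarrow> smooth_fun (\<lambda>x. frechet_derivative f (at x) (axis i 1))"
  by (erule smooth_fun.cases) blast

lemma smooth_fun_const: "smooth_fun (\<lambda>x. c)"
proof (coinduction arbitrary: c rule: smooth_fun.coinduct)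
  case smooth_fun
  show ?case by (rule exI[of _ "\<lambda>x. c"]) auto
qed

text \<open>The derivative of a product is a sum of products, so the coinduction needs a predicate that is
  closed under both operations.\<close>

inductive smooth_cl :: "(real^'n \<Rightarrow> real) \<Rightarrow> bool" where
  base: "smooth_fun f \<Longrightarrow> smooth_cl f"
| add: "smooth_cl f \<Longrightarrow> smooth_cl g \<Longrightarrow> smooth_cl (\<lambda>x. f x + g x)"
| mult: "smooth_cl f \<Longrightarrow> smooth_cl g \<Longrightarrow> smooth_cl (\<lambda>x. f x * g x)"
| inverse: "smooth_cl f \<Longrightarrow> (\<And>x. f x \<noteq> 0) \<Longrightarrow> smooth_cl (\<lambda>x. inverse (f x))"

text \<open>The rules for sums, products and reciprocals express every partial derivative through
  members of the class, so the class is a valid invariant for the coinduction on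
  \<open>smooth_fun\<close>.\<close>

lemma smooth_cl_step:
  assumes "smooth_cl f"
  shows "(\<forall>x. f differentiable (at x)) \<and>
    (\<forall>i. smooth_cl (\<lambda>x. frechet_derivative f (at x) (axis i 1)))"
  using assms
proof induction
  case (base f)
  then show ?case
    by (auto intro: smooth_cl.base smooth_fun_differentiable smooth_fun_partial)
next
  case (add f g)
  have "frechet_derivative (\<lambda>x. f x + g x) (at x) =
      (\<lambda>h. frechet_derivative f (at x) h + frechet_derivative g (at x) h)" for x
    using add.IH by (intro frechet_derivative_at[symmetric] has_derivative_add)
      (auto simp: frechet_derivative_works[symmetric])
  with add show ?case
    by (auto intro!: smooth_cl.add)
next
  case (mult f g)
  have "frechet_derivative (\<lambda>x. f x * g x) (at x) =
      (\<lambda>h. f x * frechet_derivative g (at x) h + frechet_derivative f (at x) h * g x)" for x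
    using mult.IH by (intro frechet_derivative_at[symmetric] has_derivative_mult)
      (auto simp: frechet_derivative_works[symmetric])
  with mult show ?case
    by (auto intro!: smooth_cl.add smooth_cl.mult)
next
  case (inverse f)
  have *: "((\<lambda>x. inverse (f x)) has_derivative
      (\<lambda>h. (-1) * (inverse (f x) * frechet_derivative f (at x) h * inverse (f x)))) (at x)" for x
  proof -
    have "(f has_derivative frechet_derivative f (at x)) (at x)"
      using inverse.IH by (simp add: frechet_derivative_works[symmetric])
    from Deriv.has_derivative_inverse[OF inverse.hyps(2) this] show ?thesis by simp
  qed
  have "frechet_derivative (\<lambda>x. inverse (f x)) (at x) =
      (\<lambda>h. (-1) * (inverse (f x) * frechet_derivative f (at x) h * inverse (f x)))" for x
    using frechet_derivative_at[OF *] by simp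
  moreover have "smooth_cl (\<lambda>x. (-1) * (inverse (f x) * frechet_derivative f (at x) (axis i 1) * inverse (f x)))" for i
    using inverse
    by (intro smooth_cl.mult smooth_cl.inverse smooth_cl.base[OF smooth_fun_const]) auto
  ultimately have "\<forall>i. smooth_cl (\<lambda>x. frechet_derivative (\<lambda>x. inverse (f x)) (at x) (axis i 1))"
    by simp
  then show ?case
    using differentiableI[OF *] by simp
qed

lemma smooth_cl_imp_smooth: "smooth_cl f \<Longrightarrow> smooth_fun f"
proof (coinduction arbitrary: f rule: smooth_fun.coinduct)
  case (smooth_fun f)
  from smooth_cl_step[OF this] show ?case
    by (intro exI[of _ f]) simp
qed

lemma smooth_fun_add: "smooth_fun f \<Longrightarrow> smooth_fun g \<Longrightarrow> smooth_fun (\<lambda>x. f x + g x)"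
  by (rule smooth_cl_imp_smooth[OF smooth_cl.add[OF smooth_cl.base smooth_cl.base]])

lemma smooth_fun_mult: "smooth_fun f \<Longrightarrow> smooth_fun g \<Longrightarrow> smooth_fun (\<lambda>x. f x * g x)"
  by (rule smooth_cl_imp_smooth[OF smooth_cl.mult[OF smooth_cl.base smooth_cl.base]])

lemma smooth_fun_divide:
  assumes "smooth_fun f" "smooth_fun g" "\<And>x. g x \<noteq> 0"
  shows "smooth_fun (\<lambda>x. f x / g x)"
  unfolding divide_inverse using assms
  by (blast intro: smooth_cl_imp_smooth smooth_cl.mult[OF smooth_cl.base smooth_cl.inverse[OF smooth_cl.base]])

lemma smooth_fun_diff:
  assumes "smooth_fun f" "smooth_fun g"
  shows "smooth_fun (\<lambda>x. f x - g x)"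
  using smooth_fun_add[OF assms(1) smooth_fun_mult[OF smooth_fun_const[of "-1"] assms(2)]] by simp

lemma smooth_fun_prod:
  "finite I \<Longrightarrow> (\<And>i. i \<in> I \<Longrightarrow> smooth_fun (f i)) \<Longrightarrow> smooth_fun (\<lambda>x. \<Prod>i\<in>I. f i x)"
  by (induction I rule: finite_induct) (auto intro: smooth_fun_const smooth_fun_mult)

section \<open>A smooth cutoff built from exp (-1/t)\<close>

text \<open>All derivatives of exp (-1/t), extended by 0, have this shape; carrying the polynomial
  as a parameter closes the family under differentiation.\<close>

definition flat_fun :: "real poly \<Rightarrow> real \<Rightarrow> real" where
  "flat_fun p t = (if t > 0 then poly p (1 / t) * exp (- (1 / t)) else 0)"

text \<open>With s = 1/t one has d/dt = -s^2 d/ds, and -s^2 times the derivative of p(s) exp (-s) is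
  s^2 (p - p')(s) exp (-s).\<close>

definition flat_deriv :: "real poly \<Rightarrow> real poly" where
  "flat_deriv p = [:0, 0, 1:] * (p - pderiv p)"

lemma poly_times_exp_tendsto_0: "((\<lambda>x. poly p x * exp (- x)) \<longlongrightarrow> (0::real)) at_top"
proof -
  have "((\<lambda>x. \<Sum>i\<le>degree p. coeff p i * (x ^ i / exp x)) \<longlongrightarrow> (\<Sum>i\<le>degree p. coeff p i * 0)) at_top"
    by (intro tendsto_intros tendsto_power_div_exp_0)
  then show ?thesis
    by (simp add: poly_altdef exp_minus divide_inverse sum_distrib_right mult.assoc)
qed

lemma flat_fun_has_derivative:
  "(flat_fun p has_real_derivative flat_fun (flat_deriv p) t) (at t)"
proof (cases t "0::real" rule: linorder_cases)
  case less
  have "((\<lambda>t. 0) has_real_derivative 0) (at t)" by simp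
  then have "(flat_fun p has_real_derivative 0) (at t)"
    by (rule has_field_derivative_transform_within_open[of _ _ _ "{..<0}"])
      (use less in \<open>auto simp: flat_fun_def\<close>)
  with less show ?thesis by (simp add: flat_fun_def)
next
  case greater
  have "((\<lambda>t. poly p (1/t) * exp (-(1/t))) has_real_derivative
      poly (flat_deriv p) (1/t) * exp (-(1/t))) (at t)"
    using greater
    by (auto intro!: derivative_eq_intros DERIV_chain2[OF poly_DERIV]
        simp: flat_deriv_def field_simps power2_eq_square)
  then have "(flat_fun p has_real_derivative poly (flat_deriv p) (1/t) * exp (-(1/t))) (at t)"
    by (rule has_field_derivative_transform_within_open[of _ _ _ "{0<..}"])
      (use greater in \<open>auto simp: flat_fun_def\<close>)
  with greater show ?thesis by (simp add: flat_fun_def)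
next
  case equal
  have "((\<lambda>h. flat_fun p h / h) \<longlongrightarrow> 0) (at 0)"
  proof (rule filterlim_split_at_real)
    show "((\<lambda>h. flat_fun p h / h) \<longlongrightarrow> 0) (at_left 0)"
      by (rule tendsto_eventually) (auto simp: eventually_at_filter flat_fun_def)
    \<comment> \<open>Dividing by h adds a factor 1/h, and (1/h) p(1/h) is the polynomial
      \<open>pCons 0 p\<close> at 1/h.\<close>
    have "((\<lambda>h. poly (pCons 0 p) (inverse h) * exp (- inverse h)) \<longlongrightarrow> 0) (at_right (0::real))"
      by (rule filterlim_compose[OF poly_times_exp_tendsto_0 filterlim_inverse_at_top_right])
    then show "((\<lambda>h. flat_fun p h / h) \<longlongrightarrow> 0) (at_right 0)"
      by (rule Lim_transform_eventually)
        (auto simp: eventually_at_filter flat_fun_def field_simps)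
  qed
  then show ?thesis
    using equal by (simp add: has_field_derivative_iff flat_fun_def)
qed

text \<open>A partial derivative has the same form with another constant and with
  \<open>flat_deriv p\<close> for \<open>p\<close>; the factor \<open>c\<close> is in the statement
  so that the coinduction closes.\<close>

lemma smooth_fun_scaled_flat:
  "smooth_fun (\<lambda>x::real^'n. c * flat_fun p (a * x $ i + b))"
proof (coinduction arbitrary: c p rule: smooth_fun.coinduct)
  case (smooth_fun c q)
  define f where "f = (\<lambda>x::real^'n. c * flat_fun q (a * x $ i + b))"
  have D: "(f has_derivative (\<lambda>h. c * (flat_fun (flat_deriv q) (a * x $ i + b) * (a * h $ i)))) (at x)" for x
  proof -
    have "((\<lambda>x. a * x $ i + b) has_derivative (\<lambda>h. a * h $ i)) (at x)"
      by (auto intro!: derivative_eq_intros bounded_linear.has_derivative[OF bounded_linear_vec_nth])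
    from has_derivative_compose[OF this flat_fun_has_derivative[unfolded has_field_derivative_def]]
    show ?thesis unfolding f_def by (intro has_derivative_mult_right)
  qed
  have "(\<lambda>x. frechet_derivative f (at x) (axis j 1)) =
    (\<lambda>x. (c * a * axis j 1 $ i) * flat_fun (flat_deriv q) (a * x $ i + b))" for j
    using frechet_derivative_at[OF D, symmetric] by (auto simp: fun_eq_iff)
  then show ?case
    using differentiableI[OF D] unfolding f_def[symmetric] by blast
qed

lemma smooth_fun_flat: "smooth_fun (\<lambda>x::real^'n. flat_fun p (a * x $ i + b))"
  using smooth_fun_scaled_flat[of 1] by simp

definition smooth_step :: "real \<Rightarrow> real" where
  "smooth_step t = flat_fun 1 t / (flat_fun 1 t + flat_fun 1 (1 - t))"

lemma flat_fun_denom_pos: "flat_fun 1 t + flat_fun 1 (1 - t) > 0"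
  by (cases "t > 0") (auto simp: flat_fun_def add_pos_nonneg)

lemma smooth_step_0: "t \<le> 0 \<Longrightarrow> smooth_step t = 0"
  by (simp add: smooth_step_def flat_fun_def)

lemma smooth_step_1: "t \<ge> 1 \<Longrightarrow> smooth_step t = 1"
  by (simp add: smooth_step_def flat_fun_def)

lemma smooth_fun_smooth_step: "smooth_fun (\<lambda>x::real^'n. smooth_step (x $ i + c))"
proof -
  have 1: "smooth_fun (\<lambda>x::real^'n. flat_fun 1 (x $ i + c))"
    using smooth_fun_flat[of 1 1 i c] by simp
  have 2: "smooth_fun (\<lambda>x::real^'n. flat_fun 1 (1 - (x $ i + c)))"
    using smooth_fun_flat[of 1 "-1" i "1 - c"] by (simp add: algebra_simps)
  show ?thesis
    unfolding smooth_step_def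
    by (rule smooth_fun_divide[OF 1 smooth_fun_add[OF 1 2]])
      (rule less_imp_neq[OF flat_fun_denom_pos, symmetric])
qed

text \<open>In each coordinate a bump supported in [-2, 1], written as a difference of two steps at
  distance 2, the period, so that its translates by periods telescope to one.\<close>

definition cutoff :: "real^'n \<Rightarrow> real" where
  "cutoff x = (\<Prod>i\<in>UNIV. smooth_step (x $ i + 2) - smooth_step (x $ i))"

lemma smooth_fun_cutoff: "smooth_fun cutoff"
  unfolding cutoff_def
  using smooth_fun_smooth_step[of _ 0]
  by (auto intro!: smooth_fun_prod smooth_fun_diff smooth_fun_smooth_step)

lemma cutoff_nonzero:
  assumes "cutoff x \<noteq> 0"
  shows "- 2 < x $ i \<and> x $ i < 1"
proof -
  have "smooth_step (x $ i + 2) \<noteq> smooth_step (x $ i)"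
    using assms by (auto simp: cutoff_def)
  then show ?thesis
    using smooth_step_0[of "x $ i + 2"] smooth_step_0[of "x $ i"]
      smooth_step_1[of "x $ i + 2"] smooth_step_1[of "x $ i"]
    by (cases "x $ i \<le> - 2"; cases "x $ i \<ge> 1") auto
qed

text \<open>The shifts are -2, 0 and 2, and the sum collapses to \<open>smooth_step\<close> at t + 4
  minus \<open>smooth_step\<close> at t - 2, where the values are 1 and 0.\<close>

lemma smooth_step_telescope:
  assumes "\<bar>t\<bar> \<le> 1"
  shows "(\<Sum>j\<le>2::nat. smooth_step (t + (2 * real j - 2) + 2) - smooth_step (t + (2 * real j - 2))) = 1"
  using assms smooth_step_0[of "t - 2"] smooth_step_1[of "t + 4"]
  by (simp add: numeral_2_eq_2 atMost_Suc add.commute)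

section \<open>Square-integrable functions\<close>

text \<open>Values in any Euclidean space are allowed, so functions, gradients, fluxes and pairs of
  value and gradient share one L^2 calculus.\<close>

definition sq_integrable :: "'a measure \<Rightarrow> ('a \<Rightarrow> 'b::euclidean_space) \<Rightarrow> bool" where
  "sq_integrable M f \<longleftrightarrow> f \<in> borel_measurable M \<and> integrable M (\<lambda>x. (norm (f x))\<^sup>2)"

lemma sq_integrable_measurable: "sq_integrable M f \<Longrightarrow> f \<in> borel_measurable M"
  and sq_integrable_integrable: "sq_integrable M f \<Longrightarrow> integrable M (\<lambda>x. (norm (f x))\<^sup>2)"
  by (simp_all add: sq_integrable_def)

lemma sq_integrable_bound:
  fixes f :: "'a \<Rightarrow> 'b::euclidean_space" and g :: "'a \<Rightarrow> 'c::euclidean_space"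
  assumes "sq_integrable M f" "g \<in> borel_measurable M" "AE x in M. norm (g x) \<le> C * norm (f x)"
  shows "sq_integrable M g"
  unfolding sq_integrable_def
proof
  have "integrable M (\<lambda>x. C\<^sup>2 * (norm (f x))\<^sup>2)"
    using assms(1) by (simp add: sq_integrable_def)
  then show "integrable M (\<lambda>x. (norm (g x))\<^sup>2)"
  proof (rule Bochner_Integration.integrable_bound)
    show "AE x in M. norm ((norm (g x))\<^sup>2) \<le> norm (C\<^sup>2 * (norm (f x))\<^sup>2)"
      using assms(3)
    proof eventually_elim
      case (elim x)
      from power_mono[OF this, of 2] show ?case
        by (simp add: power_mult_distrib)
    qed
  qed (use assms(2) in measurable)
qed (fact assms(2))

lemma norm_add_sq_le: "(norm (a + b))\<^sup>2 \<le> 2 * (norm a)\<^sup>2 + 2 * (norm (b::'a::real_inner))\<^sup>2"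
proof -
  have "0 \<le> (norm (a - b))\<^sup>2" by simp
  then show ?thesis by (simp add: power2_norm_eq_inner algebra_simps inner_commute)
qed

lemma sq_integrable_scaleR: "sq_integrable M f \<Longrightarrow> sq_integrable M (\<lambda>x. c *\<^sub>R f x)"
  by (rule sq_integrable_bound[of M f _ "\<bar>c\<bar>"]) (auto simp: sq_integrable_def)

lemma sq_integrable_add:
  assumes "sq_integrable M f" "sq_integrable M g"
  shows "sq_integrable M (\<lambda>x. f x + g x)"
  unfolding sq_integrable_def
proof
  have [measurable]: "f \<in> borel_measurable M" "g \<in> borel_measurable M"
    using assms by (auto simp: sq_integrable_def)
  show "(\<lambda>x. f x + g x) \<in> borel_measurable M" by measurable
  have "integrable M (\<lambda>x. 2 * (norm (f x))\<^sup>2 + 2 * (norm (g x))\<^sup>2)"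
    using assms by (simp add: sq_integrable_def)
  then show "integrable M (\<lambda>x. (norm (f x + g x))\<^sup>2)"
    by (rule Bochner_Integration.integrable_bound) (auto intro: norm_add_sq_le order_trans[OF _ abs_ge_self])
qed

lemma sq_integrable_diff:
  "sq_integrable M f \<Longrightarrow> sq_integrable M g \<Longrightarrow> sq_integrable M (\<lambda>x. f x - g x)"
  using sq_integrable_add[OF _ sq_integrable_scaleR[of M g "-1"], of f] by simp

lemma sq_integrable_Pair:
  assumes "sq_integrable M f" "sq_integrable M g"
  shows "sq_integrable M (\<lambda>x. (f x, g x))"
  using assms by (auto simp: sq_integrable_def norm_Pair intro!: borel_measurable_Pair)

lemma sq_integrable_fst:
  fixes f :: "'a \<Rightarrow> 'b::euclidean_space \<times> 'c::euclidean_space"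
  assumes "sq_integrable M f"
  shows "sq_integrable M (\<lambda>x. fst (f x))"
proof (rule sq_integrable_bound[OF assms, of _ 1])
  show "(\<lambda>x. fst (f x)) \<in> borel_measurable M"
    using sq_integrable_measurable[OF assms]
    by (rule borel_measurable_continuous_on[OF continuous_on_fst[OF continuous_on_id]])
  show "AE x in M. norm (fst (f x)) \<le> 1 * norm (f x)"
    by (intro AE_I2) (metis mult_1 norm_fst_le prod.collapse)
qed

lemma sq_integrable_snd:
  fixes f :: "'a \<Rightarrow> 'b::euclidean_space \<times> 'c::euclidean_space"
  assumes "sq_integrable M f"
  shows "sq_integrable M (\<lambda>x. snd (f x))"
proof (rule sq_integrable_bound[OF assms, of _ 1])
  show "(\<lambda>x. snd (f x)) \<in> borel_measurable M"
    using sq_integrable_measurable[OF assms]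
    by (rule borel_measurable_continuous_on[OF continuous_on_snd[OF continuous_on_id]])
  show "AE x in M. norm (snd (f x)) \<le> 1 * norm (f x)"
    by (intro AE_I2) (metis mult_1 norm_snd_le prod.collapse)
qed

lemma (in finite_measure) sq_integrable_const: "sq_integrable M (\<lambda>x. c)"
  by (simp add: sq_integrable_def)

lemma sq_integrable_inner:
  assumes "sq_integrable M f" "sq_integrable M g"
  shows "integrable M (\<lambda>x. f x \<bullet> g x)"
proof -
  have [measurable]: "f \<in> borel_measurable M" "g \<in> borel_measurable M"
    using assms by (auto simp: sq_integrable_def)
  have "integrable M (\<lambda>x. (norm (f x))\<^sup>2 + (norm (g x))\<^sup>2)"
    using assms by (simp add: sq_integrable_def)
  then show ?thesis
  proof (rule Bochner_Integration.integrable_bound)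
    have "\<bar>f x \<bullet> g x\<bar> \<le> (norm (f x))\<^sup>2 + (norm (g x))\<^sup>2" for x
    proof -
      have "\<bar>f x \<bullet> g x\<bar> \<le> norm (f x) * norm (g x)" by (rule Cauchy_Schwarz_ineq2)
      moreover have "0 \<le> (norm (f x) - norm (g x))\<^sup>2" by simp
      moreover have "0 \<le> (norm (f x))\<^sup>2" "0 \<le> (norm (g x))\<^sup>2" by auto
      ultimately show ?thesis by (simp add: power2_diff)
    qed
    then show "AE x in M. norm (f x \<bullet> g x) \<le> norm ((norm (f x))\<^sup>2 + (norm (g x))\<^sup>2)"
      by (auto intro: order_trans[OF _ abs_ge_self])
  qed measurable
qed

lemma discriminant_le:
  fixes a b c :: real
  assumes "0 \<le> a" "\<And>t. 0 \<le> a * t\<^sup>2 - 2 * c * t + b"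
  shows "c\<^sup>2 \<le> a * b"
proof (cases "a = 0")
  case True
  have "c = 0"
  proof (rule ccontr)
    assume "c \<noteq> 0"
    \<comment> \<open>At this point the affine function takes the value -1.\<close>
    then show False using assms(2)[of "(b + 1) / (2 * c)"] True by simp
  qed
  then show ?thesis using True by simp
next
  case False
  with assms(1) have "a > 0" by simp
  with assms(2)[of "c / a"] show ?thesis
    by (simp add: field_simps power2_eq_square)
qed

text \<open>The integral of |t f - g|^2 is a nonnegative quadratic in t, so
  \<open>discriminant_le\<close> applies. The squared form keeps square roots out of the later
  estimates.\<close>

lemma sq_integrable_Cauchy_Schwarz:
  assumes "sq_integrable M f" "sq_integrable M g"
  shows "(LINT x|M. f x \<bullet> g x)\<^sup>2 \<le> (LINT x|M. (norm (f x))\<^sup>2) * (LINT x|M. (norm (g x))\<^sup>2)"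
proof (rule discriminant_le)
  show "0 \<le> (LINT x|M. (norm (f x))\<^sup>2)" by simp
next
  fix t :: real
  note [simp] = assms[THEN sq_integrable_integrable] sq_integrable_inner[OF assms]
  have "0 \<le> (LINT x|M. (norm (t *\<^sub>R f x - g x))\<^sup>2)" by simp
  also have "(LINT x|M. (norm (t *\<^sub>R f x - g x))\<^sup>2) =
    (LINT x|M. t\<^sup>2 * (norm (f x))\<^sup>2 - 2 * t * (f x \<bullet> g x) + (norm (g x))\<^sup>2)"
    by (intro Bochner_Integration.integral_cong)
      (auto simp: power2_norm_eq_inner algebra_simps inner_commute power2_eq_square[of t])
  also have "\<dots> = (LINT x|M. (norm (f x))\<^sup>2) * t\<^sup>2 - 2 * (LINT x|M. f x \<bullet> g x) * t + (LINT x|M. (norm (g x))\<^sup>2)"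
    by simp
  finally show "0 \<le> (LINT x|M. (norm (f x))\<^sup>2) * t\<^sup>2 - 2 * (LINT x|M. f x \<bullet> g x) * t + (LINT x|M. (norm (g x))\<^sup>2)" .
qed

lemma sq_integrable_tendsto_inner:
  assumes "\<And>n. sq_integrable M (v n)" "sq_integrable M u" "sq_integrable M z"
    and lim: "(\<lambda>n. LINT x|M. (norm (v n x - u x))\<^sup>2) \<longlonglongrightarrow> 0"
  shows "(\<lambda>n. LINT x|M. v n x \<bullet> z x) \<longlonglongrightarrow> (LINT x|M. u x \<bullet> z x)"
proof -
  have d: "sq_integrable M (\<lambda>x. v n x - u x)" for n
    using assms by (intro sq_integrable_diff) auto
  have eq: "(LINT x|M. (v n x - u x) \<bullet> z x) = (LINT x|M. v n x \<bullet> z x) - (LINT x|M. u x \<bullet> z x)" for n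
    using assms by (simp add: inner_diff_left sq_integrable_inner)
  have "(\<lambda>n. (LINT x|M. (v n x - u x) \<bullet> z x)\<^sup>2) \<longlonglongrightarrow> 0"
  proof (rule tendsto_sandwich[OF _ _ tendsto_const])
    show "(\<lambda>n. (LINT x|M. (norm (v n x - u x))\<^sup>2) * (LINT x|M. (norm (z x))\<^sup>2)) \<longlonglongrightarrow> 0"
      by (rule tendsto_mult_left_zero[OF lim])
    show "\<forall>\<^sub>F n in sequentially. (LINT x|M. (v n x - u x) \<bullet> z x)\<^sup>2
      \<le> (LINT x|M. (norm (v n x - u x))\<^sup>2) * (LINT x|M. (norm (z x))\<^sup>2)"
      using sq_integrable_Cauchy_Schwarz[OF d assms(3)] by simp
  qed auto
  then have "(\<lambda>n. sqrt ((LINT x|M. (v n x - u x) \<bullet> z x)\<^sup>2)) \<longlonglongrightarrow> sqrt 0"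
    by (rule tendsto_real_sqrt)
  then show ?thesis
    by (simp add: eq tendsto_rabs_zero_iff LIM_zero_iff)
qed

text \<open>Writing |v|^2 = |v - u|^2 + 2 v.u - |u|^2 reduces the claim to the convergence of inner
  products.\<close>

lemma sq_integrable_tendsto_norm:
  assumes "\<And>n. sq_integrable M (v n)" "sq_integrable M u"
    and lim: "(\<lambda>n. LINT x|M. (norm (v n x - u x))\<^sup>2) \<longlonglongrightarrow> 0"
  shows "(\<lambda>n. LINT x|M. (norm (v n x))\<^sup>2) \<longlonglongrightarrow> (LINT x|M. (norm (u x))\<^sup>2)"
proof -
  note [simp] = sq_integrable_integrable sq_integrable_inner assms(1,2)
  have d: "sq_integrable M (\<lambda>x. v n x - u x)" for n
    using assms by (intro sq_integrable_diff) auto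
  have "(LINT x|M. (norm (v n x))\<^sup>2) =
      (LINT x|M. (norm (v n x - u x))\<^sup>2 + 2 * (v n x \<bullet> u x) - (norm (u x))\<^sup>2)" for n
    by (intro Bochner_Integration.integral_cong) (auto simp: power2_norm_eq_inner algebra_simps inner_commute)
  also have "\<dots> n = (LINT x|M. (norm (v n x - u x))\<^sup>2) + 2 * (LINT x|M. v n x \<bullet> u x) - (LINT x|M. (norm (u x))\<^sup>2)" for n
    using d[of n] by simp
  finally have eq: "(LINT x|M. (norm (v n x))\<^sup>2) = \<dots> n" for n .
  have "(\<lambda>n. (LINT x|M. (norm (v n x - u x))\<^sup>2) + 2 * (LINT x|M. v n x \<bullet> u x) - (LINT x|M. (norm (u x))\<^sup>2))
     \<longlonglongrightarrow> 0 + 2 * (LINT x|M. u x \<bullet> u x) - (LINT x|M. (norm (u x))\<^sup>2)"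
    using assms by (intro tendsto_intros lim sq_integrable_tendsto_inner) auto
  then show ?thesis
    by (simp add: eq power2_norm_eq_inner[symmetric])
qed

section \<open>Periodic functions on the cube\<close>

abbreviation lborelQ :: "(real^'n) measure" where
  "lborelQ \<equiv> restrict_space lborel cubeQ"

lemma One_nth: "(One :: real^'n) $ i = 1"
  by (simp only: cart_eq_inner_axis) (simp add: inner_sum_left_Basis)

lemma mem_cubeQ: "x \<in> cubeQ \<longleftrightarrow> (\<forall>i. \<bar>x $ i\<bar> < 1)"
  unfolding cubeQ_def mem_box_cart vector_uminus_component One_nth
  by (auto simp: abs_less_iff minus_less_iff)

lemma open_cubeQ: "open cubeQ"
  unfolding cubeQ_def by (rule open_box)

lemma sets_cubeQ [measurable]: "cubeQ \<in> sets borel"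
  by (rule borel_open[OF open_cubeQ])

lemma space_lborelQ [simp]: "space lborelQ = cubeQ"
  by (simp add: space_restrict_space)

lemma measurable_lborelQ: "f \<in> borel_measurable borel \<Longrightarrow> f \<in> borel_measurable lborelQ"
  by (rule measurable_restrict_space1) simp

lemma finite_measure_restrict_lborel:
  fixes S :: "'a::euclidean_space set"
  assumes "bounded S" "S \<in> sets borel"
  shows "finite_measure (restrict_space lborel S)"
  using emeasure_bounded_finite[OF assms(1)] assms(2)
  by (intro finite_measureI) (simp add: emeasure_restrict_space space_restrict_space)

lemma bounded_cubeQ: "bounded cubeQ"
  unfolding cubeQ_def by (rule bounded_box)

lemma finite_measure_lborelQ: "finite_measure (lborelQ :: (real^'n) measure)"
  by (rule finite_measure_restrict_lborel[OF bounded_cubeQ sets_cubeQ])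

interpretation lborelQ: finite_measure lborelQ
  by (rule finite_measure_lborelQ)

lemma continuous_sq_integrable_bounded:
  fixes f :: "'a::euclidean_space \<Rightarrow> 'b::euclidean_space"
  assumes "continuous_on UNIV f" "bounded S" "S \<in> sets borel"
  shows "sq_integrable (restrict_space lborel S) f"
proof -
  interpret finite_measure "restrict_space lborel S"
    by (rule finite_measure_restrict_lborel[OF assms(2,3)])
  have "compact (f ` closure S)"
    using assms by (intro compact_continuous_image) (auto intro: continuous_on_subset)
  then obtain B where "\<And>x. x \<in> closure S \<Longrightarrow> norm (f x) \<le> B"
    using compact_imp_bounded bounded_iff by (metis imageI)
  then have B: "\<And>x. x \<in> S \<Longrightarrow> norm (f x) \<le> B"
    using closure_subset by blast
  have "f \<in> borel_measurable (restrict_space lborel S)"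
    by (rule measurable_restrict_space1) (simp add: borel_measurable_continuous_onI assms(1))
  then show ?thesis
    by (rule sq_integrable_bound[OF sq_integrable_const[of "1::real"], of _ B])
      (auto simp: B space_restrict_space intro!: AE_I2)
qed

lemma continuous_sq_integrable:
  fixes f :: "real^'n \<Rightarrow> 'b::euclidean_space"
  assumes "continuous_on UNIV f"
  shows "sq_integrable lborelQ f"
  by (rule continuous_sq_integrable_bounded[OF assms bounded_cubeQ sets_cubeQ])

lemma continuous_integrable_cubeQ:
  fixes f :: "real^'n \<Rightarrow> real"
  assumes "continuous_on UNIV f"
  shows "integrable lborelQ f"
  using sq_integrable_inner[OF continuous_sq_integrable[OF assms] lborelQ.sq_integrable_const[of 1]]
  by simp

section \<open>Tiling by translates of the cell and folding of integrals\<close>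

text \<open>The indicator of [-1, 1)^d. Half-open cells tile the space without gaps or overlaps, so
  their indicators sum to one at every point; the product form reduces this to one
  coordinate.\<close>

definition half_open_ind :: "real^'n \<Rightarrow> real" where
  "half_open_ind x = (\<Prod>i\<in>UNIV. if -1 \<le> x $ i \<and> x $ i < 1 then 1 else 0)"

lemma half_open_ind_nonzero: "half_open_ind x \<noteq> 0 \<Longrightarrow> -1 \<le> x $ i \<and> x $ i < 1"
  by (auto simp: half_open_ind_def split: if_splits)

lemma measurable_half_open_ind [measurable]: "half_open_ind \<in> borel_measurable borel"
  unfolding half_open_ind_def by measurable

text \<open>The two indicators can differ only on the hyperplanes x $ i = -1, which are null
  sets.\<close>

lemma half_open_ind_AE: "AE x in lborel. indicator cubeQ x = half_open_ind x"
proof -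
  have "AE x::real^'n in lborel. \<forall>i\<in>UNIV. x \<bullet> axis i 1 \<noteq> - 1"
    by (intro AE_finite_allI AE_lborel_inner_neq) auto
  then show ?thesis
  proof eventually_elim
    case (elim x)
    then have "x $ i \<noteq> - 1" for i
      by (simp add: inner_axis)
    then have "(-1 \<le> x $ i \<and> x $ i < 1) = (\<bar>x $ i\<bar> < 1)" for i
      by (metis abs_less_iff less_le minus_less_iff)
    then show ?case
      by (auto simp: half_open_ind_def mem_cubeQ indicator_def)
  qed
qed

lemma
  fixes f :: "real^'n \<Rightarrow> real"
  assumes [measurable]: "f \<in> borel_measurable borel"
  shows integrable_lborelQ_iff: "integrable lborelQ f \<longleftrightarrow> integrable lborel (\<lambda>x. half_open_ind x * f x)"
    and integral_lborelQ_eq: "integral\<^sup>L lborelQ f = (LINT x|lborel. half_open_ind x * f x)"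
proof -
  have "AE x in lborel. indicator cubeQ x * f x = half_open_ind x * f x"
    using half_open_ind_AE by eventually_elim simp
  then show "integrable lborelQ f \<longleftrightarrow> integrable lborel (\<lambda>x. half_open_ind x * f x)"
    "integral\<^sup>L lborelQ f = (LINT x|lborel. half_open_ind x * f x)"
    by (subst integrable_restrict_space integral_restrict_space, simp, simp,
        intro integrable_cong_AE integral_cong_AE; measurable)+
qed

text \<open>The indices 0, 1, 2 stand for the translations -2, 0, 2 of a coordinate. The resulting
  3^d translates of the half-open cell fill [-3, 3)^d, which contains every support that is folded
  below.\<close>

definition shifts :: "('n \<Rightarrow> nat) set" where
  "shifts = PiE UNIV (\<lambda>_. {..2})"

definition shift :: "('n \<Rightarrow> nat) \<Rightarrow> real^'n" where
  "shift k = (\<chi> i. 2 * real (k i) - 2)"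

lemma finite_shifts: "finite (shifts :: ('n::finite \<Rightarrow> nat) set)"
  unfolding shifts_def by (intro finite_PiE) auto

lemma sum_shifts_prod:
  fixes h :: "'n::finite \<Rightarrow> nat \<Rightarrow> real"
  assumes "\<And>i. (\<Sum>j\<le>2. h i j) = 1"
  shows "(\<Sum>k\<in>shifts. \<Prod>i\<in>UNIV. h i (k i)) = 1"
  using prod_sum_PiE[of UNIV "\<lambda>_. {..2}" h] assms by (simp add: shifts_def)

lemma sum_shifts_half_open_ind:
  assumes "\<And>i. -3 \<le> x $ i \<and> x $ i < 3"
  shows "(\<Sum>k\<in>shifts. half_open_ind (x + shift k)) = 1"
    and "(\<Sum>k\<in>shifts. half_open_ind (x - shift k)) = 1"
proof -
  let ?h = "\<lambda>t::real. if -1 \<le> t \<and> t < 1 then 1 else (0::real)"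
  have "(\<Sum>j\<le>2. ?h (t + (2 * real j - 2))) = 1 \<and> (\<Sum>j\<le>2. ?h (t - (2 * real j - 2))) = 1"
    if "-3 \<le> t \<and> t < 3" for t
    using that by (auto simp: numeral_2_eq_2 atMost_Suc)
  with assms show "(\<Sum>k\<in>shifts. half_open_ind (x + shift k)) = 1"
      "(\<Sum>k\<in>shifts. half_open_ind (x - shift k)) = 1"
    unfolding half_open_ind_def shift_def vector_add_component vector_minus_component vec_lambda_beta
    using sum_shifts_prod[of "\<lambda>i j. ?h (x $ i + (2 * real j - 2))"]
      sum_shifts_prod[of "\<lambda>i j. ?h (x $ i - (2 * real j - 2))"] by blast+
qed

lemma sum_shifts_cutoff:
  assumes "x \<in> cubeQ"
  shows "(\<Sum>k\<in>shifts. cutoff (x + shift k)) = 1"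
  unfolding cutoff_def shift_def vector_add_component vec_lambda_beta
  using assms
  by (intro sum_shifts_prod[where h="\<lambda>i j. smooth_step (x $ i + (2 * real j - 2) + 2) - smooth_step (x $ i + (2 * real j - 2))"]
      smooth_step_telescope) (simp add: mem_cubeQ less_imp_le)

lemma Qperiodic_axis:
  assumes "Qperiodic f"
  shows "f (x + (2 * real m - 2) *\<^sub>R axis i 1) = f x"
proof (induction m)
  case 0
  \<comment> \<open>The base case is the translation by -2, obtained from periodicity at the point
    already moved back.\<close>
  have "f (x + (2 * real 0 - 2) *\<^sub>R axis i 1 + 2 *\<^sub>R axis i 1) = f (x + (2 * real 0 - 2) *\<^sub>R axis i 1)"
    using assms unfolding Qperiodic_def by blast
  then show ?case by simp
next
  case (Suc m)
  have "f (x + (2 * real m - 2) *\<^sub>R axis i 1 + 2 *\<^sub>R axis i 1) = f (x + (2 * real m - 2) *\<^sub>R axis i 1)"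
    using assms unfolding Qperiodic_def by blast
  with Suc show ?case by (simp add: algebra_simps)
qed

lemma Qperiodic_shift:
  assumes "Qperiodic f"
  shows "f (x + shift k) = f x"
proof -
  have "f (x + (\<Sum>i\<in>I. (2 * real (k i) - 2) *\<^sub>R axis i 1)) = f x" if "finite I" for I
    using that
  proof (induction I)
    case (insert i I)
    have "f (x + (\<Sum>i\<in>insert i I. (2 * real (k i) - 2) *\<^sub>R axis i 1)) =
      f ((x + (\<Sum>i\<in>I. (2 * real (k i) - 2) *\<^sub>R axis i 1)) + (2 * real (k i) - 2) *\<^sub>R axis i 1)"
      unfolding sum.insert[OF insert.hyps] by (rule arg_cong[of _ _ f]) (simp only: ac_simps)
    also have "\<dots> = f x"
      unfolding Qperiodic_axis[OF assms] by (rule insert.IH)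
    finally show ?case .
  qed simp
  from this[of UNIV] have "f (x + (\<Sum>i\<in>UNIV. (2 * real (k i) - 2) *\<^sub>R axis i 1)) = f x" by simp
  moreover have "(\<Sum>i\<in>UNIV. (2 * real (k i) - 2) *\<^sub>R axis i 1) = shift k"
    using basis_expansion[of "shift k"] by (simp add: shift_def scalar_mult_eq_scaleR)
  ultimately show ?thesis by simp
qed

lemma
  fixes f :: "'a::euclidean_space \<Rightarrow> real"
  assumes [measurable]: "f \<in> borel_measurable borel"
  shows integrable_lborel_shift: "integrable lborel (\<lambda>x. f (x + c)) \<longleftrightarrow> integrable lborel f"
    and integral_lborel_shift: "(LINT x|lborel. f (x + c)) = integral\<^sup>L lborel f"
proof -
  show "integrable lborel (\<lambda>x. f (x + c)) \<longleftrightarrow> integrable lborel f"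
    using integrable_distr_eq[of "(+) c" lborel borel f]
    by (simp add: lborel_distr_plus add.commute)
  show "(LINT x|lborel. f (x + c)) = integral\<^sup>L lborel f"
    using integral_distr[of "(+) c" lborel borel f]
    by (simp add: lborel_distr_plus add.commute)
qed

text \<open>The support is cut along the tiling, and each piece is translated back to the
  cell.\<close>

lemma integral_unfold_shifts:
  fixes w :: "real^'n \<Rightarrow> real"
  assumes [measurable]: "w \<in> borel_measurable borel"
    and supp: "\<And>x i. w x \<noteq> 0 \<Longrightarrow> -3 \<le> x $ i \<and> x $ i < 3"
    and int: "\<And>k. integrable lborelQ (\<lambda>x. w (x + shift k))"
  shows "integral\<^sup>L lborel w = (LINT x|lborelQ. (\<Sum>k\<in>shifts. w (x + shift k)))"
proof -
  have A: "integrable lborel (\<lambda>x. half_open_ind (x - shift k) * w x)"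
    and B: "(LINT x|lborel. half_open_ind (x - shift k) * w x) = (LINT x|lborelQ. w (x + shift k))" for k
  proof -
    have "integrable lborel (\<lambda>x. half_open_ind x * w (x + shift k))"
      using int[of k] by (subst (asm) integrable_lborelQ_iff) auto
    then show "integrable lborel (\<lambda>x. half_open_ind (x - shift k) * w x)"
      using integrable_lborel_shift[of "\<lambda>x. half_open_ind (x - shift k) * w x" "shift k"] by simp
    show "(LINT x|lborel. half_open_ind (x - shift k) * w x) = (LINT x|lborelQ. w (x + shift k))"
      using integral_lborel_shift[of "\<lambda>x. half_open_ind (x - shift k) * w x" "shift k"]
      by (subst integral_lborelQ_eq) auto
  qed
  have "w x = (\<Sum>k\<in>shifts. half_open_ind (x - shift k) * w x)" for x
    using supp[of x] sum_shifts_half_open_ind(2)[of x] by (cases "w x = 0") (auto simp flip: sum_distrib_right)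
  then have "integral\<^sup>L lborel w = (LINT x|lborel. (\<Sum>k\<in>shifts. half_open_ind (x - shift k) * w x))"
    by (intro Bochner_Integration.integral_cong) auto
  also have "\<dots> = (\<Sum>k\<in>shifts. LINT x|lborelQ. w (x + shift k))"
    by (subst Bochner_Integration.integral_sum) (auto simp: A B)
  also have "\<dots> = (LINT x|lborelQ. (\<Sum>k\<in>shifts. w (x + shift k)))"
    by (rule Bochner_Integration.integral_sum[symmetric]) (rule int)
  finally show ?thesis .
qed

text \<open>The translated cell stays inside [-3, 3)^d. Folding it back leaves \<open>f\<close>, by
  periodicity, times a sum of translated indicators, which is one.\<close>

lemma integral_periodic_translate:
  fixes f :: "real^'n \<Rightarrow> real"
  assumes f: "continuous_on UNIV f" "Qperiodic f" and z: "\<And>i. \<bar>z $ i\<bar> \<le> 1"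
  shows "(LINT x|lborelQ. f (x + z)) = integral\<^sup>L lborelQ f"
proof -
  have [measurable]: "f \<in> borel_measurable borel"
    by (rule borel_measurable_continuous_onI[OF f(1)])
  define w where "w x = half_open_ind (x - z) * f x" for x
  have [measurable]: "w \<in> borel_measurable borel" unfolding w_def by measurable
  have w: "w (x + shift k) = half_open_ind ((x - z) + shift k) * f x" for x k
    using Qperiodic_shift[OF f(2)] by (simp add: w_def algebra_simps)
  have "(LINT x|lborelQ. f (x + z)) = (LINT x|lborel. half_open_ind x * f (x + z))"
    by (rule integral_lborelQ_eq) measurable
  also have "\<dots> = integral\<^sup>L lborel w"
    using integral_lborel_shift[of w z] by (simp add: w_def)
  also have "\<dots> = (LINT x|lborelQ. (\<Sum>k\<in>shifts. w (x + shift k)))"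
  proof (rule integral_unfold_shifts)
    fix x i assume "w x \<noteq> 0"
    then have "half_open_ind (x - z) \<noteq> 0" by (simp add: w_def)
    from half_open_ind_nonzero[OF this, of i] show "-3 \<le> x $ i \<and> x $ i < 3"
      using z[of i] by (auto simp: abs_le_iff)
  next
    fix k
    have "\<bar>half_open_ind x\<bar> \<le> 1" for x :: "real^'n"
      unfolding half_open_ind_def abs_prod by (intro prod_le_1) auto
    then show "integrable lborelQ (\<lambda>x. w (x + shift k))"
      unfolding w
      by (intro Bochner_Integration.integrable_bound[OF continuous_integrable_cubeQ[OF f(1)]])
        (auto intro!: measurable_lborelQ AE_I2 simp: abs_mult mult_left_le_one_le)
  qed measurable
  also have "\<dots> = integral\<^sup>L lborelQ f"
  proof (rule Bochner_Integration.integral_cong)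
    fix x :: "real^'n" assume "x \<in> space lborelQ"
    then have "-3 \<le> (x - z) $ i \<and> (x - z) $ i < 3" for i
      using z[of i] by (auto simp: mem_cubeQ abs_le_iff abs_less_iff dest!: spec[of _ i])
    from sum_shifts_half_open_ind(1)[OF this] show "(\<Sum>k\<in>shifts. w (x + shift k)) = f x"
      by (simp add: w flip: sum_distrib_right)
  qed simp
  finally show ?thesis .
qed

section \<open>Weak formulation on the periodicity cell\<close>

lemma has_derivative_grad:
  assumes "v differentiable (at x)"
  shows "(v has_derivative (\<lambda>h. grad v x \<bullet> h)) (at x)"
proof -
  let ?D = "frechet_derivative v (at x)"
  have D: "(v has_derivative ?D) (at x)"
    using assms by (simp add: frechet_derivative_works)
  have "?D h = grad v x \<bullet> h" for h
  proof -
    have "?D h = ?D (\<Sum>i\<in>UNIV. h $ i *\<^sub>R axis i 1)"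
      using basis_expansion[of h] by (simp add: scalar_mult_eq_scaleR)
    also have "\<dots> = (\<Sum>i\<in>UNIV. h $ i *\<^sub>R ?D (axis i 1))"
      using has_derivative_linear[OF D] by (simp add: linear_sum linear_cmul)
    finally show ?thesis
      by (simp add: grad_def inner_vec_def mult.commute)
  qed
  then have "?D = (\<lambda>h. grad v x \<bullet> h)" by (rule ext)
  with D show ?thesis by simp
qed

lemma grad_eqI:
  assumes "(v has_derivative (\<lambda>h. w \<bullet> h)) (at x)"
  shows "grad v x = w"
  using frechet_derivative_at[OF assms, symmetric] by (simp add: grad_def vec_eq_iff inner_axis)

lemma smooth_fun_continuous: "smooth_fun v \<Longrightarrow> continuous_on UNIV v"
  by (auto intro!: differentiable_imp_continuous_on simp: differentiable_on_def smooth_fun_differentiable)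

lemma smooth_fun_continuous_grad: "smooth_fun v \<Longrightarrow> continuous_on UNIV (grad v)"
  unfolding grad_def[abs_def]
  by (intro continuous_intros smooth_fun_continuous smooth_fun_partial)

text \<open>Pairing value and gradient makes H^1 convergence an L^2 convergence of a single function
  and turns the weak equations into an orthogonality
  \<open>jet \<psi> x \<bullet> Z x\<close>.\<close>

definition jet :: "(real^'n \<Rightarrow> real) \<Rightarrow> real^'n \<Rightarrow> real \<times> (real^'n)" where
  "jet v x = (v x, grad v x)"

lemma smooth_fun_continuous_jet: "smooth_fun v \<Longrightarrow> continuous_on UNIV (jet v)"
  unfolding jet_def[abs_def]
  by (intro continuous_intros smooth_fun_continuous smooth_fun_continuous_grad)

lemma sq_integrable_jet: "smooth_fun v \<Longrightarrow> sq_integrable lborelQ (jet v)"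
  by (intro continuous_sq_integrable smooth_fun_continuous_jet)

lemma jet_sum:
  assumes "\<And>i. i \<in> I \<Longrightarrow> f i differentiable (at x)"
  shows "jet (\<lambda>x. \<Sum>i\<in>I. c i * f i x) x = (\<Sum>i\<in>I. c i *\<^sub>R jet (f i) x)"
proof -
  have "((\<lambda>x. \<Sum>i\<in>I. c i * f i x) has_derivative (\<lambda>h. \<Sum>i\<in>I. c i * (grad (f i) x \<bullet> h))) (at x)"
    by (intro has_derivative_sum has_derivative_mult_right has_derivative_grad assms)
  then have "((\<lambda>x. \<Sum>i\<in>I. c i * f i x) has_derivative (\<lambda>h. (\<Sum>i\<in>I. c i *\<^sub>R grad (f i) x) \<bullet> h)) (at x)"
    by (simp add: inner_sum_left)
  from grad_eqI[OF this] show ?thesis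
    by (simp add: jet_def prod_eq_iff fst_sum snd_sum)
qed

lemma jet_shift:
  assumes "v differentiable (at (x + c))"
  shows "jet (\<lambda>y. v (y + c)) x = jet v (x + c)"
proof -
  have "((\<lambda>y. v (y + c)) has_derivative (\<lambda>h. grad v (x + c) \<bullet> h)) (at x)"
    by (rule has_derivative_compose[of "\<lambda>y. y + c" "\<lambda>h. h" x UNIV v, OF _ has_derivative_grad[OF assms]])
      (auto intro!: derivative_eq_intros)
  from grad_eqI[OF this] show ?thesis by (simp add: jet_def)
qed

lemma jet_cong_open:
  assumes "open S" "x \<in> S" "\<And>y. y \<in> S \<Longrightarrow> v y = w y" "w differentiable (at x)"
  shows "jet v x = jet w x"
proof -
  have "(v has_derivative (\<lambda>h. grad w x \<bullet> h)) (at x)"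
    using has_derivative_grad[OF assms(4)] assms(1-3)
    by (intro has_derivative_transform_within_open[of w _ x UNIV S v]) auto
  from grad_eqI[OF this] assms(2,3) show ?thesis by (simp add: jet_def)
qed

lemma Qperiodic_jet:
  assumes "smooth_fun v" "Qperiodic v"
  shows "Qperiodic (jet v)"
  unfolding Qperiodic_def
proof (intro allI)
  fix x i
  have "(\<lambda>y. v (y + 2 *\<^sub>R axis i 1)) = v"
    using assms(2) unfolding Qperiodic_def by blast
  then show "jet v (x + 2 *\<^sub>R axis i 1) = jet v x"
    using jet_shift[where v=v and x=x and c="2 *\<^sub>R axis i 1"] smooth_fun_differentiable[OF assms(1)] by simp
qed

text \<open>Testing the equation on the whole space with \<open>cutoff * v\<close>: the translates of the cutoff by
  the periods add up to one, hence the integral over the whole space folds to the one over the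
  cube.\<close>

lemma weak_form_periodic:
  fixes Z :: "real^'n \<Rightarrow> real \<times> (real^'n)"
  assumes Z: "Z \<in> borel_measurable borel" "Qperiodic Z" "sq_integrable lborelQ Z"
    and eq: "\<And>\<psi>. test_fun \<psi> \<Longrightarrow> (LINT x|lborel. jet \<psi> x \<bullet> Z x) = 0"
    and v: "smooth_fun v" "Qperiodic v"
  shows "(LINT x|lborelQ. jet v x \<bullet> Z x) = 0"
proof -
  define \<psi> where "\<psi> x = cutoff x * v x" for x
  have smooth: "smooth_fun \<psi>"
    unfolding \<psi>_def by (intro smooth_fun_mult smooth_fun_cutoff v)
  have nz: "- 2 < x $ i \<and> x $ i < 1" if "\<psi> x \<noteq> 0" for x i
    using that cutoff_nonzero[of x i] by (auto simp: \<psi>_def)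
  have "{x. \<psi> x \<noteq> 0} \<subseteq> cbox (\<chi> i. -2) (\<chi> i. 1)"
    using nz by (auto simp: mem_box_cart less_imp_le)
  then have "bounded {x. \<psi> x \<noteq> 0}"
    using bounded_cbox bounded_subset by blast
  with smooth have "test_fun \<psi>" by (simp add: test_fun_def)
  define w where "w x = jet \<psi> x \<bullet> Z x" for x
  have Zp: "Z (x + shift k) = Z x" for x k
    by (rule Qperiodic_shift[OF Z(2)])
  have [measurable]: "Z \<in> borel_measurable borel" "jet \<psi> \<in> borel_measurable borel"
    using Z smooth by (auto intro: borel_measurable_continuous_onI smooth_fun_continuous_jet)
  have "0 = integral\<^sup>L lborel w"
    using eq[OF \<open>test_fun \<psi>\<close>] by (simp add: w_def[abs_def])
  also have "\<dots> = (LINT x|lborelQ. (\<Sum>k\<in>shifts. w (x + shift k)))"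
  proof (rule integral_unfold_shifts)
    show "w \<in> borel_measurable borel" unfolding w_def by measurable
  next
    fix x i assume w: "w x \<noteq> 0"
    show "- 3 \<le> x $ i \<and> x $ i < 3"
    proof (rule ccontr)
      assume *: "\<not> (- 3 \<le> x $ i \<and> x $ i < 3)"
      \<comment> \<open>The gradient vanishes only where \<open>\<psi>\<close> is zero on a whole
        neighbourhood; this open set lies outside the support of \<open>\<psi>\<close> and contains
        \<open>x\<close>.\<close>
      define S where "S = {y::real^'n. y $ i < -2} \<union> {y. y $ i > 2}"
      have "open S" unfolding S_def
        by (intro open_Un open_Collect_less continuous_intros)
      moreover have "x \<in> S" using * by (auto simp: S_def)
      moreover have "\<psi> y = 0" if "y \<in> S" for y
        using that nz[of y i] by (cases "\<psi> y = 0") (auto simp: S_def)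
      ultimately have "jet \<psi> x = jet (\<lambda>_. 0) x"
        by (intro jet_cong_open) auto
      also have "\<dots> = 0"
        by (simp add: jet_def grad_def zero_prod_def vec_eq_iff)
      finally show False using w by (simp add: w_def)
    qed
  next
    fix k
    have "continuous_on UNIV (\<lambda>x. jet \<psi> (x + shift k))"
      by (intro continuous_on_compose2[OF smooth_fun_continuous_jet[OF smooth]] continuous_intros) auto
    from sq_integrable_inner[OF continuous_sq_integrable[OF this] Z(3)]
    show "integrable lborelQ (\<lambda>x. w (x + shift k))"
      by (simp add: w_def Zp)
  qed
  also have "\<dots> = (LINT x|lborelQ. jet v x \<bullet> Z x)"
  proof (rule Bochner_Integration.integral_cong)
    fix x :: "real^'n" assume "x \<in> space lborelQ"
    then have x: "x \<in> cubeQ" by simp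
    have d: "(\<lambda>y. \<psi> (y + shift k)) differentiable (at x)" for k
      using differentiable_compose[of \<psi> "\<lambda>y. y + shift k" x UNIV] smooth_fun_differentiable[OF smooth]
      by simp
    have "(\<Sum>k\<in>shifts. 1 * \<psi> (y + shift k)) = v y" if "y \<in> cubeQ" for y
      using sum_shifts_cutoff[OF that]
      by (simp add: \<psi>_def Qperiodic_shift[OF v(2)] flip: sum_distrib_right)
    \<comment> \<open>The translates add up to \<open>v\<close> on the cube, which is open, so the
      gradients agree there as well.\<close>
    then have "jet v x = jet (\<lambda>y. \<Sum>k\<in>shifts. 1 * \<psi> (y + shift k)) x"
      by (intro jet_cong_open[OF open_cubeQ x] differentiable_sum finite_shifts) (auto simp: d)
    also have "\<dots> = (\<Sum>k\<in>shifts. jet \<psi> (x + shift k))"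
      by (subst jet_sum) (auto simp: d jet_shift smooth_fun_differentiable[OF smooth])
    finally show "(\<Sum>k\<in>shifts. w (x + shift k)) = jet v x \<bullet> Z x"
      by (simp add: w_def Zp inner_sum_left)
  qed simp
  finally show ?thesis by simp
qed

section \<open>Poincare inequality\<close>

lemma
  fixes f :: "'a::euclidean_space \<Rightarrow> 'b::euclidean_space \<Rightarrow> real"
  assumes f: "continuous_on UNIV (\<lambda>p. f (fst p) (snd p))"
    and A: "bounded A" "A \<in> sets borel" and B: "bounded B" "B \<in> sets borel"
  shows Fubini_continuous_eq:
      "(LINT y|restrict_space lborel B. LINT x|restrict_space lborel A. f x y) =
        (LINT x|restrict_space lborel A. LINT y|restrict_space lborel B. f x y)"
    and Fubini_continuous_integrable:
      "integrable (restrict_space lborel A) (\<lambda>x. LINT y|restrict_space lborel B. f x y)"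
proof -
  let ?M = "restrict_space lborel A" and ?N = "restrict_space lborel B"
  interpret M: finite_measure ?M by (rule finite_measure_restrict_lborel[OF A])
  interpret N: finite_measure ?N by (rule finite_measure_restrict_lborel[OF B])
  interpret P: pair_sigma_finite ?M ?N ..
  interpret MN: finite_measure "?M \<Otimes>\<^sub>M ?N"
    by (rule finite_measure_pair_measure) unfold_locales
  have int: "integrable (?M \<Otimes>\<^sub>M ?N) (case_prod f)"
  proof -
    let ?g = "\<lambda>p. f (fst p) (snd p)"
    have "compact (?g ` (closure A \<times> closure B))"
      using A B by (intro compact_continuous_image compact_Times continuous_on_subset[OF f]) auto
    then have "bounded (?g ` (closure A \<times> closure B))"
      by (rule compact_imp_bounded)
    then obtain C where C: "\<And>p. p \<in> closure A \<times> closure B \<Longrightarrow> norm (?g p) \<le> C"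
      unfolding bounded_iff by blast
    have [measurable]: "?g \<in> borel_measurable (borel \<Otimes>\<^sub>M borel)"
      using borel_measurable_continuous_onI[OF f] by (simp add: borel_prod)
    have id: "(\<lambda>x. x) \<in> measurable ?M borel" "(\<lambda>x. x) \<in> measurable ?N borel"
      by (auto intro: measurable_restrict_space1)
    have "(\<lambda>p. p) \<in> measurable (?M \<Otimes>\<^sub>M ?N) (borel \<Otimes>\<^sub>M borel)"
      using measurable_Pair[OF measurable_compose[OF measurable_fst id(1)] measurable_compose[OF measurable_snd id(2)]]
      by simp
    from measurable_compose[OF this \<open>?g \<in> _\<close>]
    have m: "?g \<in> borel_measurable (?M \<Otimes>\<^sub>M ?N)" .
    have "integrable (?M \<Otimes>\<^sub>M ?N) ?g"
      using C[OF SigmaI[OF subsetD[OF closure_subset] subsetD[OF closure_subset]]]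
      by (intro MN.integrable_const_bound[of _ C] AE_I2 m)
        (auto simp: space_pair_measure space_restrict_space)
    then show ?thesis
      by (simp add: case_prod_beta')
  qed
  show "(LINT y|?N. LINT x|?M. f x y) = (LINT x|?M. LINT y|?N. f x y)"
    by (rule P.Fubini_integral[OF int])
  show "integrable ?M (\<lambda>x. LINT y|?N. f x y)"
    by (rule P.integrable_fst[OF int])
qed

text \<open>The fundamental theorem of calculus along the segment from x to x + z, followed by
  Cauchy-Schwarz against the constant 1 on [0, 1].\<close>

lemma difference_le_integral_grad:
  fixes v :: "real^'n \<Rightarrow> real"
  assumes "smooth_fun v"
  shows "(v (x + z) - v x)\<^sup>2 \<le> (LINT t|restrict_space lborel {0..1}. (grad v (x + t *\<^sub>R z) \<bullet> z)\<^sup>2)"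
proof -
  let ?I = "restrict_space lborel {0..1::real}"
  let ?f = "\<lambda>t. grad v (x + t *\<^sub>R z) \<bullet> z"
  have c: "continuous_on UNIV ?f"
    by (intro continuous_intros continuous_on_compose2[OF smooth_fun_continuous_grad[OF assms]]) auto
  have "((\<lambda>t. v (x + t *\<^sub>R z)) has_vector_derivative ?f t) (at t within {0..1})" for t
  proof -
    have 1: "((\<lambda>t. x + t *\<^sub>R z) has_derivative (\<lambda>h. h *\<^sub>R z)) (at t within {0..1})"
      by (auto intro!: derivative_eq_intros)
    from has_derivative_compose[OF 1 has_derivative_grad[OF smooth_fun_differentiable[OF assms]]]
    show ?thesis
      by (simp add: has_vector_derivative_def)
  qed
  then have "integral\<^sup>L lborel (\<lambda>t. indicator {0..1} t *\<^sub>R ?f t) = v (x + 1 *\<^sub>R z) - v (x + 0 *\<^sub>R z)"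
    by (intro integral_FTC_atLeastAtMost continuous_on_subset[OF c]) auto
  then have "v (x + z) - v x = (LINT t|?I. ?f t \<bullet> 1)"
    by (simp add: integral_restrict_space)
  also have "\<dots>\<^sup>2 \<le> (LINT t|?I. (norm (?f t))\<^sup>2) * (LINT t|?I. (norm (1::real))\<^sup>2)"
    by (intro sq_integrable_Cauchy_Schwarz continuous_sq_integrable_bounded c) auto
  also have "(LINT t|?I. (norm (1::real))\<^sup>2) = 1"
    by (simp add: measure_restrict_space space_restrict_space)
  finally show ?thesis by simp
qed

text \<open>After the order of integration is exchanged, the inner integral over the cell is
  independent of t, by periodic translation invariance.\<close>

lemma translation_estimate:
  fixes v :: "real^'n \<Rightarrow> real"
  assumes v: "smooth_fun v" "Qperiodic v" and z: "\<And>i. \<bar>z $ i\<bar> \<le> 1"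
  shows "(LINT x|lborelQ. (v (x + z) - v x)\<^sup>2) \<le> (norm z)\<^sup>2 * (LINT x|lborelQ. (norm (grad v x))\<^sup>2)"
proof -
  let ?I = "restrict_space lborel {0..1::real}"
  interpret I: finite_measure ?I by (rule finite_measure_restrict_lborel) auto
  let ?g = "\<lambda>x. (grad v x \<bullet> z)\<^sup>2"
  have cg: "continuous_on UNIV ?g"
    by (intro continuous_intros smooth_fun_continuous_grad v)
  have pg: "Qperiodic ?g"
    using Qperiodic_jet[OF v] by (auto simp: Qperiodic_def jet_def)
  have c2: "continuous_on UNIV (\<lambda>p. ?g (fst p + snd p *\<^sub>R z))"
    by (rule continuous_on_compose2[OF cg]) (auto intro!: continuous_intros)
  have ci: "integrable lborelQ (\<lambda>x. LINT t|?I. ?g (x + t *\<^sub>R z))"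
    by (intro Fubini_continuous_integrable c2 bounded_cubeQ sets_cubeQ) auto
  have "(LINT x|lborelQ. (v (x + z) - v x)\<^sup>2) \<le> (LINT x|lborelQ. LINT t|?I. ?g (x + t *\<^sub>R z))"
  proof (rule integral_mono[OF _ ci])
    show "integrable lborelQ (\<lambda>x. (v (x + z) - v x)\<^sup>2)"
      by (intro continuous_integrable_cubeQ continuous_intros smooth_fun_continuous v
          continuous_on_compose2[OF smooth_fun_continuous[OF v(1)]]) auto
  qed (rule difference_le_integral_grad[OF v(1)])
  also have "\<dots> = (LINT t|?I. LINT x|lborelQ. ?g (x + t *\<^sub>R z))"
    by (intro Fubini_continuous_eq[symmetric] c2 bounded_cubeQ sets_cubeQ) auto
  also have "\<dots> = (LINT t|?I. LINT x|lborelQ. ?g x)"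
  proof (rule Bochner_Integration.integral_cong)
    fix t assume "t \<in> space ?I"
    then have t: "0 \<le> t" "t \<le> 1" by (auto simp: space_restrict_space)
    have "\<bar>(t *\<^sub>R z) $ i\<bar> \<le> 1" for i
      using mult_mono[OF t(2) z[of i]] t by (simp add: abs_mult)
    then show "(LINT x|lborelQ. ?g (x + t *\<^sub>R z)) = (LINT x|lborelQ. ?g x)"
      by (rule integral_periodic_translate[OF cg pg])
  qed simp
  also have "\<dots> = (LINT x|lborelQ. ?g x)"
    by (simp add: measure_restrict_space space_restrict_space)
  also have "\<dots> \<le> (LINT x|lborelQ. (norm z)\<^sup>2 * (norm (grad v x))\<^sup>2)"
  proof (intro integral_mono continuous_integrable_cubeQ cg)
    fix x
    show "?g x \<le> (norm z)\<^sup>2 * (norm (grad v x))\<^sup>2"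
      using power_mono[OF Cauchy_Schwarz_ineq2[of "grad v x" z], of 2]
      by (simp add: power_mult_distrib mult.commute)
  qed (intro continuous_intros smooth_fun_continuous_grad v)
  finally show ?thesis by simp
qed

lemma norm_sq_le_on_cubeQ:
  fixes z :: "real^'n"
  assumes "z \<in> cubeQ"
  shows "(norm z)\<^sup>2 \<le> real CARD('n)"
proof -
  have "(z $ i)\<^sup>2 \<le> 1" for i
    using assms by (simp add: mem_cubeQ abs_square_le_1 less_imp_le)
  then have "(\<Sum>i\<in>UNIV. (z $ i)\<^sup>2) \<le> (\<Sum>i\<in>(UNIV::'n set). 1)"
    by (intro sum_mono) auto
  then show ?thesis
    by (simp add: norm_vec_def L2_set_def sum_nonneg)
qed

text \<open>The double integral of (v(x + z) - v(x))^2 over x and z in the cell is computed in two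
  ways. Expanding the square and using translation invariance gives the left side;
  \<open>translation_estimate\<close> with |z|^2 \<le> d gives the right side. The mean is kept as a
  term because approximants of a function of mean zero may have nonzero mean.\<close>

lemma Poincare_smooth:
  fixes v :: "real^'n \<Rightarrow> real"
  assumes v: "smooth_fun v" "Qperiodic v"
  shows "2 * measure lborel (cubeQ :: (real^'n) set) * (LINT x|lborelQ. (v x)\<^sup>2) - 2 * (LINT x|lborelQ. v x)\<^sup>2
    \<le> real CARD('n) * measure lborel (cubeQ :: (real^'n) set) * (LINT x|lborelQ. (norm (grad v x))\<^sup>2)"
proof -
  let ?V = "measure lborel (cubeQ :: (real^'n) set)"
  let ?D = "LINT x|lborelQ. (norm (grad v x))\<^sup>2"
  have V: "measure lborelQ (cubeQ :: (real^'n) set) = ?V"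
    by (simp add: measure_restrict_space)
  note cv = smooth_fun_continuous[OF v(1)]
  have iv [simp]: "integrable lborelQ v" "integrable lborelQ (\<lambda>x. (v x)\<^sup>2)"
    by (auto intro!: continuous_integrable_cubeQ continuous_intros cv)
  have c2: "continuous_on UNIV (\<lambda>p. (v (snd p + fst p) - v (snd p))\<^sup>2)"
    by (intro continuous_intros continuous_on_compose2[OF cv]) auto
  have c2': "continuous_on UNIV (\<lambda>p. (v (fst p + snd p) - v (fst p))\<^sup>2)"
    by (intro continuous_intros continuous_on_compose2[OF cv]) auto
  have inner: "(LINT z|lborelQ. (v (x + z) - v x)\<^sup>2) =
      (LINT z|lborelQ. (v z)\<^sup>2) - 2 * v x * (LINT z|lborelQ. v z) + ?V * (v x)\<^sup>2"
    if "x \<in> cubeQ" for x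
  proof -
    have x: "\<bar>x $ i\<bar> \<le> 1" for i using that by (simp add: mem_cubeQ less_imp_le)
    have [simp]: "integrable lborelQ (\<lambda>z. v (z + x))" "integrable lborelQ (\<lambda>z. (v (z + x))\<^sup>2)"
      by (auto intro!: continuous_integrable_cubeQ continuous_intros continuous_on_compose2[OF cv])
    have "(LINT z|lborelQ. (v (x + z) - v x)\<^sup>2) =
      (LINT z|lborelQ. (v (z + x))\<^sup>2 - 2 * v x * v (z + x) + (v x)\<^sup>2)"
      by (intro Bochner_Integration.integral_cong) (auto simp: power2_diff algebra_simps)
    also have "\<dots> = (LINT z|lborelQ. (v (z + x))\<^sup>2) - 2 * v x * (LINT z|lborelQ. v (z + x)) + ?V * (v x)\<^sup>2"
      by (simp add: V)
    also have "(LINT z|lborelQ. v (z + x)) = (LINT z|lborelQ. v z)"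
      by (rule integral_periodic_translate[OF cv v(2) x])
    also have "(LINT z|lborelQ. (v (z + x))\<^sup>2) = (LINT z|lborelQ. (v z)\<^sup>2)"
      using v(2) by (intro integral_periodic_translate[where f="\<lambda>z. (v z)\<^sup>2"] x continuous_intros cv)
        (auto simp: Qperiodic_def)
    finally show ?thesis .
  qed
  have "2 * ?V * (LINT x|lborelQ. (v x)\<^sup>2) - 2 * (LINT x|lborelQ. v x)\<^sup>2 =
    (LINT x|lborelQ. (LINT z|lborelQ. (v z)\<^sup>2) - 2 * v x * (LINT z|lborelQ. v z) + ?V * (v x)\<^sup>2)"
    by (simp add: V power2_eq_square[of "integral\<^sup>L lborelQ v"])
  also have "\<dots> = (LINT x|lborelQ. LINT z|lborelQ. (v (x + z) - v x)\<^sup>2)"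
    by (intro Bochner_Integration.integral_cong) (auto simp: inner)
  also have "\<dots> = (LINT z|lborelQ. LINT x|lborelQ. (v (x + z) - v x)\<^sup>2)"
    by (rule Fubini_continuous_eq[OF c2' bounded_cubeQ sets_cubeQ bounded_cubeQ sets_cubeQ, symmetric])
  also have "\<dots> \<le> (LINT z|(lborelQ :: (real^'n) measure). real CARD('n) * ?D)"
  proof (rule integral_mono)
    show "integrable lborelQ (\<lambda>z. LINT x|lborelQ. (v (x + z) - v x)\<^sup>2)"
      by (rule Fubini_continuous_integrable[OF c2 bounded_cubeQ sets_cubeQ bounded_cubeQ sets_cubeQ])
  next
    fix z :: "real^'n" assume "z \<in> space lborelQ"
    then have z: "z \<in> cubeQ" by simp
    have "(LINT x|lborelQ. (v (x + z) - v x)\<^sup>2) \<le> (norm z)\<^sup>2 * ?D"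
      using z by (intro translation_estimate v) (simp add: mem_cubeQ less_imp_le)
    also have "\<dots> \<le> real CARD('n) * ?D"
      by (intro mult_right_mono norm_sq_le_on_cubeQ z) simp
    finally show "(LINT x|lborelQ. (v (x + z) - v x)\<^sup>2) \<le> real CARD('n) * ?D" .
  qed simp
  also have "\<dots> = real CARD('n) * ?V * ?D"
    by (simp add: V)
  finally show ?thesis .
qed

section \<open>The closure of the smooth periodic functions\<close>

text \<open>The space of admissible test functions on the cell: an element is a pair of value and
  gradient, approximated by smooth periodic jets. It is a linear space, so combinations and errors
  can be inserted into the equations.\<close>

definition periodic_H1 :: "(real^'n \<Rightarrow> real \<times> (real^'n)) \<Rightarrow> bool" where
  "periodic_H1 U \<longleftrightarrow> sq_integrable lborelQ U \<and>
    (\<exists>v. (\<forall>n. smooth_fun (v n) \<and> Qperiodic (v n)) \<and>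
      (\<lambda>n. LINT x|lborelQ. (norm (jet (v n) x - U x))\<^sup>2) \<longlonglongrightarrow> 0)"

lemma periodic_H1_sq_integrable: "periodic_H1 U \<Longrightarrow> sq_integrable lborelQ U"
  by (simp add: periodic_H1_def)

lemma H1_closure_approx:
  assumes "H1_closure P u g"
  obtains v where "sq_integrable lborelQ (\<lambda>x. (u x, g x))"
    "\<And>n. smooth_fun (v n)" "\<And>n. Qperiodic (v n)" "\<And>n. P (v n)"
    "(\<lambda>n. LINT x|lborelQ. (norm (jet (v n) x - (u x, g x)))\<^sup>2) \<longlonglongrightarrow> 0"
proof -
  have [measurable]: "u \<in> borel_measurable borel" "g \<in> borel_measurable borel"
    using assms by (auto simp: H1_closure_def)
  obtain v where v: "\<And>n. smooth_fun (v n)" "\<And>n. Qperiodic (v n)" "\<And>n. P (v n)"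
    and l1: "(\<lambda>n. \<integral>\<^sup>+ x \<in> cubeQ. ennreal ((v n x - u x)\<^sup>2) \<partial>lborel) \<longlonglongrightarrow> 0"
    and l2: "(\<lambda>n. \<integral>\<^sup>+ x \<in> cubeQ. ennreal ((norm (grad (v n) x - g x))\<^sup>2) \<partial>lborel) \<longlonglongrightarrow> 0"
    using assms unfolding H1_closure_def by blast
  let ?U = "\<lambda>x. (u x, g x)"
  have [measurable]: "v n \<in> borel_measurable borel" "grad (v n) \<in> borel_measurable borel" for n
    using v(1)[of n] by (auto intro: borel_measurable_continuous_onI smooth_fun_continuous smooth_fun_continuous_grad)
  have mU: "(\<lambda>x. jet (v n) x - ?U x) \<in> borel_measurable lborelQ" for n
    unfolding jet_def by (rule measurable_lborelQ) measurable
  have nn: "(\<integral>\<^sup>+ x. ennreal ((norm (jet (v n) x - ?U x))\<^sup>2) \<partial>lborelQ) =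
    (\<integral>\<^sup>+ x \<in> cubeQ. ennreal ((v n x - u x)\<^sup>2) \<partial>lborel) +
    (\<integral>\<^sup>+ x \<in> cubeQ. ennreal ((norm (grad (v n) x - g x))\<^sup>2) \<partial>lborel)" for n
  proof -
    have "(norm (jet (v n) x - ?U x))\<^sup>2 = (v n x - u x)\<^sup>2 + (norm (grad (v n) x - g x))\<^sup>2" for x
      by (simp add: jet_def norm_Pair)
    then show ?thesis
      by (simp add: nn_integral_restrict_space nn_integral_add[symmetric] distrib_right)
  qed
  have lim: "(\<lambda>n. \<integral>\<^sup>+ x. ennreal ((norm (jet (v n) x - ?U x))\<^sup>2) \<partial>lborelQ) \<longlonglongrightarrow> 0"
    unfolding nn using tendsto_add[OF l1 l2] by simp
  have "\<forall>\<^sub>F n in sequentially. (\<integral>\<^sup>+ x. ennreal ((norm (jet (v n) x - ?U x))\<^sup>2) \<partial>lborelQ) < 1"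
    by (rule order_tendstoD[OF lim]) simp
  \<comment> \<open>A single approximant at finite distance already makes the limit square
    integrable, since the approximant itself is.\<close>
  then obtain N where N: "(\<integral>\<^sup>+ x. ennreal ((norm (jet (v N) x - ?U x))\<^sup>2) \<partial>lborelQ) < 1"
    by (auto simp: eventually_sequentially)
  have "sq_integrable lborelQ (\<lambda>x. jet (v N) x - ?U x)"
    unfolding sq_integrable_def
  proof
    show "integrable lborelQ (\<lambda>x. (norm (jet (v N) x - ?U x))\<^sup>2)"
    proof (rule integrableI_bounded)
      show "(\<lambda>x. (norm (jet (v N) x - ?U x))\<^sup>2) \<in> borel_measurable lborelQ"
        using mU[of N] by measurable
      show "(\<integral>\<^sup>+ x. ennreal (norm ((norm (jet (v N) x - ?U x))\<^sup>2)) \<partial>lborelQ) < \<infinity>"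
        using N less_trans[OF N, of \<infinity>] by simp
    qed
  qed (rule mU)
  from sq_integrable_diff[OF sq_integrable_jet[OF v(1)[of N]] this]
  have U: "sq_integrable lborelQ ?U" by simp
  have "(\<integral>\<^sup>+ x. ennreal ((norm (jet (v n) x - ?U x))\<^sup>2) \<partial>lborelQ) =
    ennreal (LINT x|lborelQ. (norm (jet (v n) x - ?U x))\<^sup>2)" for n
    by (intro nn_integral_eq_integral sq_integrable_integrable sq_integrable_diff sq_integrable_jet v U) simp
  with lim have "(\<lambda>n. LINT x|lborelQ. (norm (jet (v n) x - ?U x))\<^sup>2) \<longlonglongrightarrow> 0"
    by (simp add: ennreal_tendsto_0_iff)
  from that[OF U v this] show ?thesis .
qed

lemma H1_closure_periodic_H1:
  assumes "H1_closure P u g"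
  shows "periodic_H1 (\<lambda>x. (u x, g x))"
  using assms
proof (rule H1_closure_approx)
  fix v
  assume "sq_integrable lborelQ (\<lambda>x. (u x, g x))" "\<And>n. smooth_fun (v n)" "\<And>n. Qperiodic (v n)"
    "(\<lambda>n. LINT x|lborelQ. (norm (jet (v n) x - (u x, g x)))\<^sup>2) \<longlonglongrightarrow> 0"
  then show ?thesis
    unfolding periodic_H1_def by (intro conjI exI[of _ v]) auto
qed

lemma jet_lincomb:
  assumes "smooth_fun v" "smooth_fun w"
  shows "jet (\<lambda>x. a * v x + b * w x) x = a *\<^sub>R jet v x + b *\<^sub>R jet w x"
  using jet_sum[of UNIV "\<lambda>i. if i then v else w" x "\<lambda>i. if i then a else b"] assms
  by (simp add: UNIV_bool smooth_fun_differentiable add.commute)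

lemma periodic_H1_jet:
  assumes "smooth_fun v" "Qperiodic v"
  shows "periodic_H1 (jet v)"
  unfolding periodic_H1_def
  using assms by (auto intro!: sq_integrable_jet exI[of _ "\<lambda>_. v"])

lemma periodic_H1_lincomb:
  assumes "periodic_H1 U" "periodic_H1 W"
  shows "periodic_H1 (\<lambda>x. a *\<^sub>R U x + b *\<^sub>R W x)"
proof -
  obtain v where v: "\<And>n. smooth_fun (v n)" "\<And>n. Qperiodic (v n)"
    "(\<lambda>n. LINT x|lborelQ. (norm (jet (v n) x - U x))\<^sup>2) \<longlonglongrightarrow> 0"
    using assms(1) unfolding periodic_H1_def by blast
  obtain w where w: "\<And>n. smooth_fun (w n)" "\<And>n. Qperiodic (w n)"
    "(\<lambda>n. LINT x|lborelQ. (norm (jet (w n) x - W x))\<^sup>2) \<longlonglongrightarrow> 0"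
    using assms(2) unfolding periodic_H1_def by blast
  note sq = assms[THEN periodic_H1_sq_integrable]
  let ?y = "\<lambda>n x. a * v n x + b * w n x"
  let ?Y = "\<lambda>x. a *\<^sub>R U x + b *\<^sub>R W x"
  have sqY: "sq_integrable lborelQ ?Y"
    by (intro sq_integrable_add sq_integrable_scaleR sq)
  have sy: "smooth_fun (?y n)" for n
    by (intro smooth_fun_add smooth_fun_mult smooth_fun_const v w)
  have dv: "integrable lborelQ (\<lambda>x. (norm (jet (v n) x - U x))\<^sup>2)"
    and dw: "integrable lborelQ (\<lambda>x. (norm (jet (w n) x - W x))\<^sup>2)" for n
    by (intro sq_integrable_integrable sq_integrable_diff sq_integrable_jet v w sq)+
  have "(\<lambda>n. LINT x|lborelQ. (norm (jet (?y n) x - ?Y x))\<^sup>2) \<longlonglongrightarrow> 0"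
  proof (rule tendsto_sandwich[OF _ _ tendsto_const])
    let ?B = "\<lambda>n. 2 * a\<^sup>2 * (LINT x|lborelQ. (norm (jet (v n) x - U x))\<^sup>2) +
      2 * b\<^sup>2 * (LINT x|lborelQ. (norm (jet (w n) x - W x))\<^sup>2)"
    have "?B \<longlonglongrightarrow> 2 * a\<^sup>2 * 0 + 2 * b\<^sup>2 * 0"
      by (intro tendsto_intros v w)
    then show "?B \<longlonglongrightarrow> 0" by simp
    have "(LINT x|lborelQ. (norm (jet (?y n) x - ?Y x))\<^sup>2) \<le> (LINT x|lborelQ. 2 * a\<^sup>2 * (norm (jet (v n) x - U x))\<^sup>2 +
      2 * b\<^sup>2 * (norm (jet (w n) x - W x))\<^sup>2)" for n
    proof (rule integral_mono)
      show "integrable lborelQ (\<lambda>x. (norm (jet (?y n) x - ?Y x))\<^sup>2)"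
        by (intro sq_integrable_integrable sq_integrable_diff sq_integrable_jet sy sqY)
      show "integrable lborelQ (\<lambda>x. 2 * a\<^sup>2 * (norm (jet (v n) x - U x))\<^sup>2 + 2 * b\<^sup>2 * (norm (jet (w n) x - W x))\<^sup>2)"
        using dv[of n] dw[of n] by simp
      fix x
      have "jet (?y n) x - ?Y x = a *\<^sub>R (jet (v n) x - U x) + b *\<^sub>R (jet (w n) x - W x)"
        unfolding jet_lincomb[OF v(1) w(1)] by (simp add: algebra_simps)
      also have "(norm \<dots>)\<^sup>2 \<le> 2 * a\<^sup>2 * (norm (jet (v n) x - U x))\<^sup>2 + 2 * b\<^sup>2 * (norm (jet (w n) x - W x))\<^sup>2"
        using norm_add_sq_le[of "a *\<^sub>R (jet (v n) x - U x)" "b *\<^sub>R (jet (w n) x - W x)"]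
        by (simp add: power_mult_distrib)
      finally show "(norm (jet (?y n) x - ?Y x))\<^sup>2 \<le> \<dots>" .
    qed
    then show "\<forall>\<^sub>F n in sequentially. (LINT x|lborelQ. (norm (jet (?y n) x - ?Y x))\<^sup>2) \<le> ?B n"
      using dv dw by simp
  qed simp
  moreover have "Qperiodic (?y n)" for n
    using v(2)[of n] w(2)[of n] by (simp add: Qperiodic_def)
  ultimately show ?thesis
    unfolding periodic_H1_def using sqY sy by (intro conjI exI[of _ ?y]) auto
qed

lemma periodic_H1_sum:
  fixes U :: "'i \<Rightarrow> real^'n \<Rightarrow> real \<times> (real^'n)"
  assumes "finite I" "\<And>i. i \<in> I \<Longrightarrow> periodic_H1 (U i)"
  shows "periodic_H1 (\<lambda>x. \<Sum>i\<in>I. c i *\<^sub>R U i x)"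
  using assms
proof (induction I rule: finite_induct)
  case empty
  have "jet (\<lambda>_::real^'n. 0) = (\<lambda>_. 0)"
    by (simp add: fun_eq_iff jet_def grad_def zero_prod_def vec_eq_iff)
  moreover have "periodic_H1 (jet (\<lambda>_::real^'n. 0))"
    by (rule periodic_H1_jet) (auto simp: smooth_fun_const Qperiodic_def)
  ultimately show ?case by simp
next
  case (insert i I)
  then show ?case
    using periodic_H1_lincomb[of "U i" "\<lambda>x. \<Sum>i\<in>I. c i *\<^sub>R U i x" "c i" 1] by simp
qed

text \<open>Pairing with the square-integrable \<open>Z\<close> is continuous in L^2, so the
  identity passes from smooth periodic functions to their closure.\<close>

lemma weak_form_periodic_H1:
  fixes Z :: "real^'n \<Rightarrow> real \<times> (real^'n)"
  assumes Z: "Z \<in> borel_measurable borel" "Qperiodic Z" "sq_integrable lborelQ Z"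
    and eq: "\<And>\<psi>. test_fun \<psi> \<Longrightarrow> (LINT x|lborel. jet \<psi> x \<bullet> Z x) = 0"
    and U: "periodic_H1 U"
  shows "(LINT x|lborelQ. U x \<bullet> Z x) = 0"
proof -
  obtain v where v: "\<And>n. smooth_fun (v n)" "\<And>n. Qperiodic (v n)"
    "(\<lambda>n. LINT x|lborelQ. (norm (jet (v n) x - U x))\<^sup>2) \<longlonglongrightarrow> 0"
    using U unfolding periodic_H1_def by blast
  have "(\<lambda>n. LINT x|lborelQ. jet (v n) x \<bullet> Z x) \<longlonglongrightarrow> (LINT x|lborelQ. U x \<bullet> Z x)"
    by (intro sq_integrable_tendsto_inner sq_integrable_jet v Z periodic_H1_sq_integrable U)
  moreover have "(LINT x|lborelQ. jet (v n) x \<bullet> Z x) = 0" for n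
    by (rule weak_form_periodic[OF Z eq v(1,2)])
  ultimately show ?thesis
    using LIMSEQ_unique[OF _ tendsto_const] by simp
qed

lemma measure_cubeQ_pos: "measure lborel (cubeQ :: (real^'n) set) > 0"
  unfolding cubeQ_def measure_lborel_box_eq inner_diff_left inner_minus_left
  by (simp add: inner_sum_left_Basis)

lemma norm_fst_le_norm: "norm (fst p) \<le> norm p" and norm_snd_le_norm: "norm (snd p) \<le> norm p"
  by (metis norm_fst_le prod.collapse, metis norm_snd_le prod.collapse)

text \<open>Limit of \<open>Poincare_smooth\<close>: the means of the approximants tend to the mean
  of U, which is zero. The limit gives the constant d / 2, weakened here to d.\<close>

lemma Poincare_periodic_H1:
  fixes U :: "real^'n \<Rightarrow> real \<times> (real^'n)"
  assumes U: "periodic_H1 U" and mean: "(LINT x|lborelQ. fst (U x)) = 0"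
  shows "(LINT x|lborelQ. (fst (U x))\<^sup>2) \<le> real CARD('n) * (LINT x|lborelQ. (norm (snd (U x)))\<^sup>2)"
proof -
  obtain v where v: "\<And>n. smooth_fun (v n)" "\<And>n. Qperiodic (v n)"
    and lim: "(\<lambda>n. LINT x|lborelQ. (norm (jet (v n) x - U x))\<^sup>2) \<longlonglongrightarrow> 0"
    using U unfolding periodic_H1_def by blast
  let ?V = "measure lborel (cubeQ :: (real^'n) set)"
  note sqU = periodic_H1_sq_integrable[OF U]
  note sqv = sq_integrable_jet[OF v(1)]
  note int = sq_integrable_integrable[OF sq_integrable_diff[OF sqv sqU]]
  have "(\<lambda>n. LINT x|lborelQ. (norm (fst (jet (v n) x) - fst (U x)))\<^sup>2) \<longlonglongrightarrow> 0"
  proof (rule tendsto_sandwich[OF _ _ tendsto_const lim])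
    show "\<forall>\<^sub>F n in sequentially. (LINT x|lborelQ. (norm (fst (jet (v n) x) - fst (U x)))\<^sup>2)
        \<le> (LINT x|lborelQ. (norm (jet (v n) x - U x))\<^sup>2)"
      by (intro always_eventually allI integral_mono int sq_integrable_integrable sq_integrable_diff
          sq_integrable_fst sqU sqv power_mono) (auto simp flip: fst_diff real_norm_def intro: norm_fst_le_norm)
  qed simp
  note l1 = this
  have "(\<lambda>n. LINT x|lborelQ. (norm (snd (jet (v n) x) - snd (U x)))\<^sup>2) \<longlonglongrightarrow> 0"
  proof (rule tendsto_sandwich[OF _ _ tendsto_const lim])
    show "\<forall>\<^sub>F n in sequentially. (LINT x|lborelQ. (norm (snd (jet (v n) x) - snd (U x)))\<^sup>2)
        \<le> (LINT x|lborelQ. (norm (jet (v n) x - U x))\<^sup>2)"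
      by (intro always_eventually allI integral_mono int sq_integrable_integrable sq_integrable_diff
          sq_integrable_snd sqU sqv power_mono) (auto simp flip: snd_diff intro: norm_snd_le_norm)
  qed simp
  note l2 = this
  have m1: "(\<lambda>n. LINT x|lborelQ. (v n x)\<^sup>2) \<longlonglongrightarrow> (LINT x|lborelQ. (fst (U x))\<^sup>2)"
    using sq_integrable_tendsto_norm[OF sq_integrable_fst[OF sqv] sq_integrable_fst[OF sqU] l1]
    by (simp add: jet_def)
  have m2: "(\<lambda>n. LINT x|lborelQ. v n x) \<longlonglongrightarrow> 0"
    using sq_integrable_tendsto_inner[OF sq_integrable_fst[OF sqv] sq_integrable_fst[OF sqU] lborelQ.sq_integrable_const[of 1] l1]
    by (simp add: jet_def mean)
  have m3: "(\<lambda>n. LINT x|lborelQ. (norm (grad (v n) x))\<^sup>2) \<longlonglongrightarrow> (LINT x|lborelQ. (norm (snd (U x)))\<^sup>2)"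
    using sq_integrable_tendsto_norm[OF sq_integrable_snd[OF sqv] sq_integrable_snd[OF sqU] l2]
    by (simp add: jet_def)
  have "2 * ?V * (LINT x|lborelQ. (fst (U x))\<^sup>2) - 2 * 0\<^sup>2 \<le>
    real CARD('n) * ?V * (LINT x|lborelQ. (norm (snd (U x)))\<^sup>2)"
    using Poincare_smooth[OF v]
    by (intro LIMSEQ_le[OF tendsto_diff[OF tendsto_mult_left[OF m1] tendsto_mult_left[OF tendsto_power[OF m2]]]
          tendsto_mult_left[OF m3]]) blast
  then have "?V * (2 * (LINT x|lborelQ. (fst (U x))\<^sup>2)) \<le> ?V * (real CARD('n) * (LINT x|lborelQ. (norm (snd (U x)))\<^sup>2))"
    by (simp add: algebra_simps)
  then have "2 * (LINT x|lborelQ. (fst (U x))\<^sup>2) \<le> real CARD('n) * (LINT x|lborelQ. (norm (snd (U x)))\<^sup>2)"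
    by (rule mult_left_le_imp_le[OF _ measure_cubeQ_pos])
  moreover have "0 \<le> (LINT x|lborelQ. (fst (U x))\<^sup>2)" by simp
  ultimately show ?thesis by linarith
qed

text \<open>The mean is the L^2 pairing with the constant (1, 0), hence survives the limit.\<close>

lemma H1per_mean_zero:
  assumes "H1per u g"
  shows "(LINT x|lborelQ. u x) = 0"
proof -
  let ?U = "\<lambda>x. (u x, g x)"
  obtain v where v: "sq_integrable lborelQ ?U" "\<And>n. smooth_fun (v n)"
    "\<And>n. (LINT x:cubeQ|lborel. v n x) = 0"
    "(\<lambda>n. LINT x|lborelQ. (norm (jet (v n) x - ?U x))\<^sup>2) \<longlonglongrightarrow> 0"
    using assms unfolding H1per_def by (elim H1_closure_approx) blast
  have "(\<lambda>n. LINT x|lborelQ. jet (v n) x \<bullet> (1, 0)) \<longlonglongrightarrow> (LINT x|lborelQ. ?U x \<bullet> (1, 0))"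
    by (intro sq_integrable_tendsto_inner sq_integrable_jet v lborelQ.sq_integrable_const)
  moreover have "(LINT x|lborelQ. jet (v n) x \<bullet> (1, 0)) = 0" for n
    using v(3)[of n] by (simp add: jet_def integral_restrict_space set_lebesgue_integral_def)
  ultimately have "(LINT x|lborelQ. ?U x \<bullet> (1, 0)) = 0"
    using LIMSEQ_unique[OF _ tendsto_const] by simp
  then show ?thesis by simp
qed

section \<open>Elliptic coefficient fields\<close>

lemma measurable_matrix_vector_mult:
  fixes B :: "'a \<Rightarrow> real^'n^'m"
  assumes "B \<in> borel_measurable M" "f \<in> borel_measurable M"
  shows "(\<lambda>x. B x *v f x) \<in> borel_measurable M"
proof -
  have "continuous_on UNIV (\<lambda>p :: (real^'n^'m) \<times> (real^'n). fst p *v snd p)"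
    unfolding matrix_vector_mult_def by (intro continuous_intros)
  from borel_measurable_continuous_Pair[OF assms this] show ?thesis .
qed

text \<open>The upper bound follows by duality: |y|^2 = \<xi> . B y for y the transpose of B applied
  to \<xi>, and one factor |y| cancels. For y = 0 the claim is read off from the bound on B
  \<xi>.\<close>

lemma transpose_M_ab:
  assumes "B \<in> M_ab \<alpha> \<beta>"
  shows "transpose B \<in> M_ab \<alpha> \<beta>"
  unfolding M_ab_def
proof (intro CollectI allI conjI)
  fix \<xi>
  have B: "\<alpha> * (norm \<xi>)\<^sup>2 \<le> \<xi> \<bullet> (B *v \<xi>)" "norm (B *v \<xi>) \<le> \<beta> * norm \<xi>" for \<xi>
    using assms unfolding M_ab_def by blast+
  show "\<alpha> * (norm \<xi>)\<^sup>2 \<le> \<xi> \<bullet> (transpose B *v \<xi>)"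
    using B(1)[of \<xi>] by (metis dot_lmul_matrix inner_commute transpose_matrix_vector)
  let ?y = "transpose B *v \<xi>"
  have "(norm ?y)\<^sup>2 = \<xi> \<bullet> (B *v ?y)"
    by (metis dot_lmul_matrix power2_norm_eq_inner transpose_matrix_vector)
  also have "\<dots> \<le> norm \<xi> * norm (B *v ?y)" by (rule norm_cauchy_schwarz)
  also have "\<dots> \<le> norm \<xi> * (\<beta> * norm ?y)" by (intro mult_left_mono B) simp
  finally have "norm ?y * norm ?y \<le> (\<beta> * norm \<xi>) * norm ?y"
    by (simp add: power2_eq_square mult_ac)
  then show "norm ?y \<le> \<beta> * norm \<xi>"
    using B(2)[of \<xi>] order_trans[OF norm_ge_zero B(2)[of \<xi>]]
    by (cases "?y = 0") (auto simp: mult_le_cancel_right)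
qed

locale elliptic =
  fixes \<alpha> \<beta> :: real and A :: "real^'n \<Rightarrow> real^'n^'n"
  assumes coeff: "coeff_field \<alpha> \<beta> A" and \<alpha>_pos: "0 < \<alpha>"
begin

lemma measurable_A: "A \<in> borel_measurable borel"
  using coeff by (simp add: coeff_field_def)

lemma AE_M_ab: "AE x in lborelQ. A x \<in> M_ab \<alpha> \<beta>"
  using coeff unfolding coeff_field_def by (subst AE_restrict_space_iff) auto

lemma elliptic_transpose: "elliptic \<alpha> \<beta> (\<lambda>x. transpose (A x))"
proof
  have "continuous_on UNIV (transpose :: real^'n^'n \<Rightarrow> real^'n^'n)"
    unfolding transpose_def by (intro continuous_intros)
  then have "(\<lambda>x. transpose (A x)) \<in> borel_measurable borel"
    using measurable_A by (rule borel_measurable_continuous_on)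
  moreover have "AE x in lborel. transpose (A x) \<in> M_ab \<alpha> \<beta>"
    using coeff unfolding coeff_field_def by (auto intro: transpose_M_ab)
  ultimately show "coeff_field \<alpha> \<beta> (\<lambda>x. transpose (A x))"
    using coeff by (simp add: coeff_field_def Qperiodic_def)
qed (rule \<alpha>_pos)

lemma sq_integrable_flux:
  assumes "sq_integrable lborelQ f"
  shows "sq_integrable lborelQ (\<lambda>x. A x *v f x)"
proof (rule sq_integrable_bound[OF assms])
  show "(\<lambda>x. A x *v f x) \<in> borel_measurable lborelQ"
    by (intro measurable_matrix_vector_mult measurable_lborelQ measurable_A sq_integrable_measurable assms)
  show "AE x in lborelQ. norm (A x *v f x) \<le> \<beta> * norm (f x)"
    using AE_M_ab by eventually_elim (simp add: M_ab_def)
qed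

lemma coercive:
  assumes "sq_integrable lborelQ f"
  shows "\<alpha> * (LINT x|lborelQ. (norm (f x))\<^sup>2) \<le> (LINT x|lborelQ. f x \<bullet> (A x *v f x))"
proof -
  have "(LINT x|lborelQ. \<alpha> * (norm (f x))\<^sup>2) \<le> (LINT x|lborelQ. f x \<bullet> (A x *v f x))"
  proof (rule integral_mono_AE)
    show "AE x in lborelQ. \<alpha> * (norm (f x))\<^sup>2 \<le> f x \<bullet> (A x *v f x)"
      using AE_M_ab by eventually_elim (simp add: M_ab_def)
  qed (use assms in \<open>auto intro: sq_integrable_inner sq_integrable_flux sq_integrable_integrable\<close>)
  then show ?thesis by simp
qed

lemma flux_bound:
  assumes "sq_integrable lborelQ f" "sq_integrable lborelQ g"
  shows "(LINT x|lborelQ. f x \<bullet> (A x *v g x))\<^sup>2 \<le>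
    (LINT x|lborelQ. (norm (f x))\<^sup>2) * (\<beta>\<^sup>2 * (LINT x|lborelQ. (norm (g x))\<^sup>2))"
proof -
  have "(LINT x|lborelQ. (norm (A x *v g x))\<^sup>2) \<le> (LINT x|lborelQ. \<beta>\<^sup>2 * (norm (g x))\<^sup>2)"
  proof (rule integral_mono_AE)
    show "AE x in lborelQ. (norm (A x *v g x))\<^sup>2 \<le> \<beta>\<^sup>2 * (norm (g x))\<^sup>2"
      using AE_M_ab
    proof eventually_elim
      case (elim x)
      then have "norm (A x *v g x) \<le> \<beta> * norm (g x)" by (simp add: M_ab_def)
      from power_mono[OF this, of 2] show ?case by (simp add: power_mult_distrib)
    qed
  qed (use assms in \<open>auto intro: sq_integrable_flux sq_integrable_integrable\<close>)
  then have "(LINT x|lborelQ. (norm (f x))\<^sup>2) * (LINT x|lborelQ. (norm (A x *v g x))\<^sup>2) \<le>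
    (LINT x|lborelQ. (norm (f x))\<^sup>2) * (\<beta>\<^sup>2 * (LINT x|lborelQ. (norm (g x))\<^sup>2))"
    by (intro mult_left_mono) auto
  with sq_integrable_Cauchy_Schwarz[OF assms(1) sq_integrable_flux[OF assms(2)]]
  show ?thesis by linarith
qed

lemma flux_add:
  assumes "sq_integrable lborelQ f" "sq_integrable lborelQ g" "sq_integrable lborelQ h"
  shows "(LINT x|lborelQ. f x \<bullet> (A x *v (g x + h x))) =
    (LINT x|lborelQ. f x \<bullet> (A x *v g x)) + (LINT x|lborelQ. f x \<bullet> (A x *v h x))"
  using assms
  by (simp add: matrix_vector_right_distrib inner_add_right sq_integrable_inner sq_integrable_flux)

lemma flux_diff:
  assumes "sq_integrable lborelQ f" "sq_integrable lborelQ g" "sq_integrable lborelQ h"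
  shows "(LINT x|lborelQ. f x \<bullet> (A x *v (g x - h x))) =
    (LINT x|lborelQ. f x \<bullet> (A x *v g x)) - (LINT x|lborelQ. f x \<bullet> (A x *v h x))"
  using assms
  by (simp add: matrix_vector_mult_diff_distrib inner_diff_right sq_integrable_inner sq_integrable_flux)

lemma flux_sum:
  assumes "sq_integrable lborelQ f" "\<And>i. i \<in> I \<Longrightarrow> sq_integrable lborelQ (g i)"
  shows "(LINT x|lborelQ. f x \<bullet> (A x *v (\<Sum>i\<in>I. c i *\<^sub>R g i x))) =
    (\<Sum>i\<in>I. c i * (LINT x|lborelQ. f x \<bullet> (A x *v g i x)))"
proof -
  have "f x \<bullet> (A x *v (\<Sum>i\<in>I. c i *\<^sub>R g i x)) = (\<Sum>i\<in>I. c i * (f x \<bullet> (A x *v g i x)))" for x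
    by (simp add: linear_sum[OF matrix_vector_mul_linear] linear_scale[OF matrix_vector_mul_linear] inner_sum_right)
  then show ?thesis
    using assms by (simp add: sq_integrable_inner sq_integrable_flux)
qed

section \<open>Equations tested on the cell and the basic energy estimate\<close>

text \<open>The equation is an orthogonality to the field (u / S, A (\<xi> + g)), which is periodic
  and square integrable on the cell, so all of \<open>periodic_H1\<close> may be inserted.\<close>

lemma reg_corrector_weak:
  assumes H: "H1_closure P u g" and eq: "reg_corrector_eq A \<xi> S u g" and U: "periodic_H1 U"
  shows "(LINT x|lborelQ. fst (U x) * u x) / S + (LINT x|lborelQ. snd (U x) \<bullet> (A x *v (\<xi> + g x))) = 0"
proof -
  let ?Z = "\<lambda>x. ((1 / S) *\<^sub>R u x, A x *v (\<xi> + g x))"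
  have m [measurable]: "u \<in> borel_measurable borel" "g \<in> borel_measurable borel"
    using H by (auto simp: H1_closure_def)
  have p: "Qperiodic u" "Qperiodic g" "Qperiodic A"
    using H coeff by (auto simp: H1_closure_def coeff_field_def)
  note sq = periodic_H1_sq_integrable[OF H1_closure_periodic_H1[OF H]]
  have squ: "sq_integrable lborelQ u" and sqg: "sq_integrable lborelQ g"
    using sq_integrable_fst[OF sq] sq_integrable_snd[OF sq] by auto
  have sqf: "sq_integrable lborelQ (\<lambda>x. A x *v (\<xi> + g x))"
    by (intro sq_integrable_flux sq_integrable_add lborelQ.sq_integrable_const sqg)
  note sqU = periodic_H1_sq_integrable[OF U]
  have "(LINT x|lborelQ. U x \<bullet> ?Z x) = 0"
  proof (rule weak_form_periodic_H1[OF _ _ _ _ U])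
    show "?Z \<in> borel_measurable borel"
      by (intro borel_measurable_Pair measurable_matrix_vector_mult measurable_A) measurable
    show "Qperiodic ?Z" using p by (simp add: Qperiodic_def)
    show "sq_integrable lborelQ ?Z"
      by (intro sq_integrable_Pair sq_integrable_scaleR squ sqf)
    fix \<psi> :: "real^'n \<Rightarrow> real" assume "test_fun \<psi>"
    then show "(LINT x|lborel. jet \<psi> x \<bullet> ?Z x) = 0"
      using eq unfolding reg_corrector_eq_def by (simp add: jet_def mult.commute)
  qed
  moreover have "U x \<bullet> ?Z x = (fst (U x) * u x) / S + snd (U x) \<bullet> (A x *v (\<xi> + g x))" for x
    by (simp add: inner_prod_def)
  moreover have "integrable lborelQ (\<lambda>x. fst (U x) * u x)"
    using sq_integrable_inner[OF sq_integrable_fst[OF sqU] squ] by simp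
  ultimately show ?thesis
    using sq_integrable_inner[OF sq_integrable_snd[OF sqU] sqf] by simp
qed

lemma corrector_weak:
  assumes H: "H1_closure P u g" and eq: "corrector_eq A \<xi> g" and U: "periodic_H1 U"
  shows "(LINT x|lborelQ. snd (U x) \<bullet> (A x *v (\<xi> + g x))) = 0"
proof -
  let ?Z = "\<lambda>x. (0::real, A x *v (\<xi> + g x))"
  have m [measurable]: "g \<in> borel_measurable borel"
    using H by (auto simp: H1_closure_def)
  have p: "Qperiodic g" "Qperiodic A"
    using H coeff by (auto simp: H1_closure_def coeff_field_def)
  have sqg: "sq_integrable lborelQ g"
    using sq_integrable_snd[OF periodic_H1_sq_integrable[OF H1_closure_periodic_H1[OF H]]] by simp
  have "(LINT x|lborelQ. U x \<bullet> ?Z x) = 0"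
  proof (rule weak_form_periodic_H1[OF _ _ _ _ U])
    show "?Z \<in> borel_measurable borel"
      by (intro borel_measurable_Pair measurable_matrix_vector_mult measurable_A) measurable
    show "Qperiodic ?Z" using p by (simp add: Qperiodic_def)
    show "sq_integrable lborelQ ?Z"
      by (intro sq_integrable_Pair lborelQ.sq_integrable_const sq_integrable_flux sq_integrable_add sqg)
    fix \<psi> :: "real^'n \<Rightarrow> real" assume "test_fun \<psi>"
    then show "(LINT x|lborel. jet \<psi> x \<bullet> ?Z x) = 0"
      using eq unfolding corrector_eq_def by (simp add: jet_def)
  qed
  then show ?thesis by (simp add: inner_prod_def)
qed

text \<open>The pattern of every energy estimate: coercivity bounds \<alpha> X by c, Cauchy-Schwarz
  bounds c^2 by X Y; squaring the former and cancelling one factor X gives the claim.\<close>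

lemma quadratic_absorb:
  fixes X Y c :: real
  assumes "0 \<le> X" "0 \<le> Y" "\<alpha> * X \<le> c" "c\<^sup>2 \<le> X * Y"
  shows "X \<le> Y / \<alpha>\<^sup>2"
proof (cases "X = 0")
  case False
  have "(\<alpha> * X)\<^sup>2 \<le> c\<^sup>2"
    using assms \<alpha>_pos by (intro power_mono) auto
  with assms(4) have "X * (\<alpha>\<^sup>2 * X) \<le> X * Y"
    by (simp add: power_mult_distrib power2_eq_square mult_ac)
  with False assms(1) have "\<alpha>\<^sup>2 * X \<le> Y"
    by (simp add: mult_le_cancel_left)
  then show ?thesis
    using \<alpha>_pos by (simp add: field_simps)
qed (use assms in simp)

text \<open>The equation tested with its own solution. The Poincare constant d enters once, to bound
  W by its gradient in the right-hand side, and a second time in the bound for W itself.\<close>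

lemma energy_estimate:
  assumes W: "periodic_H1 W" and mean: "(LINT x|lborelQ. fst (W x)) = 0"
    and z: "sq_integrable lborelQ z"
    and eq: "(LINT x|lborelQ. snd (W x) \<bullet> (A x *v snd (W x))) = - (LINT x|lborelQ. fst (W x) * z x) / T"
  shows "(LINT x|lborelQ. (norm (snd (W x)))\<^sup>2) \<le> real CARD('n) / \<alpha>\<^sup>2 / T\<^sup>2 * (LINT x|lborelQ. (z x)\<^sup>2)"
    and "(LINT x|lborelQ. (fst (W x))\<^sup>2) \<le> (real CARD('n))\<^sup>2 / \<alpha>\<^sup>2 / T\<^sup>2 * (LINT x|lborelQ. (z x)\<^sup>2)"
proof -
  let ?X = "LINT x|lborelQ. (norm (snd (W x)))\<^sup>2"
  let ?Z = "LINT x|lborelQ. (z x)\<^sup>2"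
  note sq = periodic_H1_sq_integrable[OF W]
  have P: "(LINT x|lborelQ. (fst (W x))\<^sup>2) \<le> real CARD('n) * ?X"
    by (rule Poincare_periodic_H1[OF W mean])
  have "(LINT x|lborelQ. fst (W x) * z x)\<^sup>2 \<le> (LINT x|lborelQ. (fst (W x))\<^sup>2) * ?Z"
    using sq_integrable_Cauchy_Schwarz[OF sq_integrable_fst[OF sq] z] by simp
  also have "\<dots> \<le> (real CARD('n) * ?X) * ?Z"
    by (intro mult_right_mono P) simp
  finally have "(LINT x|lborelQ. fst (W x) * z x)\<^sup>2 / T\<^sup>2 \<le> (real CARD('n) * ?X) * ?Z / T\<^sup>2"
    by (intro divide_right_mono) auto
  then have c: "(- (LINT x|lborelQ. fst (W x) * z x) / T)\<^sup>2 \<le> ?X * (real CARD('n) / T\<^sup>2 * ?Z)"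
    by (simp add: power_divide mult_ac)
  have "?X \<le> (real CARD('n) / T\<^sup>2 * ?Z) / \<alpha>\<^sup>2"
    using coercive[OF sq_integrable_snd[OF sq]] eq by (intro quadratic_absorb[OF _ _ _ c]) auto
  then show X: "?X \<le> real CARD('n) / \<alpha>\<^sup>2 / T\<^sup>2 * ?Z"
    by (simp add: mult_ac)
  have "real CARD('n) * ?X \<le> real CARD('n) * (real CARD('n) / \<alpha>\<^sup>2 / T\<^sup>2 * ?Z)"
    by (intro mult_left_mono X) simp
  with P show "(LINT x|lborelQ. (fst (W x))\<^sup>2) \<le> (real CARD('n))\<^sup>2 / \<alpha>\<^sup>2 / T\<^sup>2 * ?Z"
    by (simp add: power2_eq_square mult_ac)
qed

end

section \<open>Regularized correctors\<close>

text \<open>The Poincare constant d times the energy bound \<beta>^2 |Q| / \<alpha>^2; it bounds the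
  squared L^2 norm of every regularized corrector. The type argument only fixes the
  dimension.\<close>

definition reg_bound :: "'n::finite itself \<Rightarrow> real \<Rightarrow> real \<Rightarrow> real" where
  "reg_bound _ \<alpha> \<beta> = real CARD('n) * (\<beta>\<^sup>2 * measure lborel (cubeQ :: (real^'n) set) / \<alpha>\<^sup>2)"

lemma reg_bound_nonneg: "0 \<le> reg_bound N \<alpha> \<beta>"
  by (simp add: reg_bound_def)

locale reg_family = elliptic \<alpha> \<beta> A for \<alpha> \<beta> :: real and A :: "real^'n \<Rightarrow> real^'n^'n" +
  fixes \<xi> :: "real^'n" and F :: "real \<Rightarrow> real^'n \<Rightarrow> real" and G :: "real \<Rightarrow> real^'n \<Rightarrow> real^'n"
  assumes unit: "norm \<xi> = 1"
    and H1: "S > 0 \<Longrightarrow> H1per_loc (F S) (G S)"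
    and reg: "S > 0 \<Longrightarrow> reg_corrector_eq A \<xi> S (F S) (G S)"
begin

lemma reg_periodic_H1: "S > 0 \<Longrightarrow> periodic_H1 (\<lambda>x. (F S x, G S x))"
  using H1_closure_periodic_H1 H1 unfolding H1per_loc_def by blast

lemma sq_integrable_F: "S > 0 \<Longrightarrow> sq_integrable lborelQ (F S)"
  using sq_integrable_fst[OF periodic_H1_sq_integrable[OF reg_periodic_H1]] by simp

lemma sq_integrable_G: "S > 0 \<Longrightarrow> sq_integrable lborelQ (G S)"
  using sq_integrable_snd[OF periodic_H1_sq_integrable[OF reg_periodic_H1]] by simp

lemma reg_weak:
  assumes "S > 0" "periodic_H1 U"
  shows "(LINT x|lborelQ. snd (U x) \<bullet> (A x *v G S x)) =
    - (LINT x|lborelQ. snd (U x) \<bullet> (A x *v \<xi>)) - (LINT x|lborelQ. fst (U x) * F S x) / S"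
  using reg_corrector_weak[OF H1[unfolded H1per_loc_def] reg] assms
    flux_add[OF sq_integrable_snd[OF periodic_H1_sq_integrable[OF assms(2)]] lborelQ.sq_integrable_const
      sq_integrable_G[OF assms(1)], of \<xi>]
  by force

text \<open>Testing with the constant 1 removes the flux and leaves the mean divided by S. This
  supplies the normalization that \<open>H1per_loc\<close> does not impose.\<close>

lemma reg_mean:
  assumes "S > 0"
  shows "(LINT x|lborelQ. F S x) = 0"
proof -
  have jet1: "jet (\<lambda>_::real^'n. 1) = (\<lambda>_. (1, 0))"
    by (simp add: fun_eq_iff jet_def grad_def vec_eq_iff)
  have "periodic_H1 (jet (\<lambda>_::real^'n. 1))"
    by (rule periodic_H1_jet) (auto simp: smooth_fun_const Qperiodic_def)
  from reg_corrector_weak[OF H1[OF assms, unfolded H1per_loc_def] reg[OF assms] this] assms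
  show ?thesis by (simp add: jet1)
qed

lemma reg_bounded:
  assumes "S > 0"
  shows "(LINT x|lborelQ. (F S x)\<^sup>2) \<le> reg_bound TYPE('n) \<alpha> \<beta>"
proof -
  note per = reg_periodic_H1[OF assms]
  let ?X = "LINT x|lborelQ. (norm (G S x))\<^sup>2"
  let ?c = "- (LINT x|lborelQ. G S x \<bullet> (A x *v \<xi>))"
  have "(LINT x|lborelQ. G S x \<bullet> (A x *v G S x)) = ?c - (LINT x|lborelQ. F S x * F S x) / S"
    using reg_weak[OF assms per] by simp
  moreover have "0 \<le> (LINT x|lborelQ. F S x * F S x) / S"
    using assms by (intro divide_nonneg_pos integral_nonneg) auto
  ultimately have 1: "\<alpha> * ?X \<le> ?c"
    using coercive[OF sq_integrable_G[OF assms]] by linarith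
  have "(LINT x|(lborelQ :: (real^'n) measure). (norm \<xi>)\<^sup>2) = measure lborel (cubeQ :: (real^'n) set)"
    by (simp add: unit measure_restrict_space)
  then have 2: "?c\<^sup>2 \<le> ?X * (\<beta>\<^sup>2 * measure lborel (cubeQ :: (real^'n) set))"
    using flux_bound[OF sq_integrable_G[OF assms] lborelQ.sq_integrable_const[of \<xi>]] by simp
  have X: "?X \<le> \<beta>\<^sup>2 * measure lborel (cubeQ :: (real^'n) set) / \<alpha>\<^sup>2"
    by (rule quadratic_absorb[OF _ _ 1 2]) auto
  have "(LINT x|lborelQ. (F S x)\<^sup>2) \<le> real CARD('n) * ?X"
    using Poincare_periodic_H1[OF per] reg_mean[OF assms] by simp
  also have "\<dots> \<le> reg_bound TYPE('n) \<alpha> \<beta>"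
    unfolding reg_bound_def by (intro mult_left_mono X) simp
  finally show ?thesis .
qed

section \<open>Linear combinations over dyadic parameters\<close>

lemma comb_base:
  assumes "T > 0"
  shows "(LINT x|lborelQ. (\<Sum>i<m. b i * F (2 ^ i * T) x)\<^sup>2) \<le> real m * reg_bound TYPE('n) \<alpha> \<beta> * (\<Sum>i<m. (b i)\<^sup>2)"
proof -
  have pos: "2 ^ i * T > 0" for i :: nat using assms by simp
  note int = sq_integrable_integrable[OF sq_integrable_F[OF pos], simplified]
  have sq: "sq_integrable lborelQ (\<lambda>x. \<Sum>i<m. b i * F (2 ^ i * T) x)"
    using sq_integrable_fst[OF periodic_H1_sq_integrable[OF periodic_H1_sum[of "{..<m}" "\<lambda>i x. (F (2 ^ i * T) x, G (2 ^ i * T) x)" b]]]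
    by (simp add: reg_periodic_H1 pos fst_sum)
  have "(LINT x|lborelQ. (\<Sum>i<m. b i * F (2 ^ i * T) x)\<^sup>2) \<le>
    (LINT x|lborelQ. (\<Sum>i<m. (b i)\<^sup>2) * (\<Sum>i<m. (F (2 ^ i * T) x)\<^sup>2))"
  proof (rule integral_mono)
    show "integrable lborelQ (\<lambda>x. (\<Sum>i<m. b i * F (2 ^ i * T) x)\<^sup>2)"
      using sq_integrable_integrable[OF sq] by simp
  qed (auto intro!: int Cauchy_Schwarz_ineq_sum)
  also have "\<dots> = (\<Sum>i<m. (b i)\<^sup>2) * (\<Sum>i<m. LINT x|lborelQ. (F (2 ^ i * T) x)\<^sup>2)"
    by (simp add: int)
  also have "\<dots> \<le> (\<Sum>i<m. (b i)\<^sup>2) * (\<Sum>i<m. reg_bound TYPE('n) \<alpha> \<beta>)"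
    by (intro mult_left_mono sum_mono reg_bounded pos sum_nonneg) auto
  finally show ?thesis by (simp add: mult_ac)
qed

text \<open>Summation of \<open>reg_weak\<close> over S = 2^i T. The weights 1 / S turn the
  coefficients b i into b i / 2^i, with 1 / T in front; this passage is iterated below.\<close>

lemma comb_weak:
  assumes T: "T > 0" and U: "periodic_H1 U"
  shows "(LINT x|lborelQ. snd (U x) \<bullet> (A x *v (\<Sum>i<m. b i *\<^sub>R G (2 ^ i * T) x))) =
    - (\<Sum>i<m. b i) * (LINT x|lborelQ. snd (U x) \<bullet> (A x *v \<xi>)) -
      (LINT x|lborelQ. fst (U x) * (\<Sum>i<m. b i / 2 ^ i * F (2 ^ i * T) x)) / T"
proof -
  have pos: "2 ^ i * T > 0" for i :: nat using T by simp
  note sqU = periodic_H1_sq_integrable[OF U]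
  have int: "integrable lborelQ (\<lambda>x. fst (U x) * F (2 ^ i * T) x)" for i :: nat
    using sq_integrable_inner[OF sq_integrable_fst[OF sqU] sq_integrable_F[OF pos]] by simp
  have "(LINT x|lborelQ. fst (U x) * (\<Sum>i<m. b i / 2 ^ i * F (2 ^ i * T) x)) =
    (LINT x|lborelQ. (\<Sum>i<m. b i / 2 ^ i * (fst (U x) * F (2 ^ i * T) x)))"
    by (simp add: sum_distrib_left mult_ac)
  also have "\<dots> = (\<Sum>i<m. b i / 2 ^ i * (LINT x|lborelQ. fst (U x) * F (2 ^ i * T) x))"
    using int by (subst Bochner_Integration.integral_sum) auto
  finally have 1: "(LINT x|lborelQ. fst (U x) * (\<Sum>i<m. b i / 2 ^ i * F (2 ^ i * T) x)) / T =
    (\<Sum>i<m. b i * ((LINT x|lborelQ. fst (U x) * F (2 ^ i * T) x) / (2 ^ i * T)))"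
    by (simp add: sum_divide_distrib)
  show ?thesis
    unfolding 1 flux_sum[OF sq_integrable_snd[OF sqU] sq_integrable_G[OF pos]] reg_weak[OF pos U]
    by (simp add: right_diff_distrib sum_subtractf sum_distrib_right sum_negf)
qed

lemma comb_periodic_H1:
  assumes "T > 0"
  shows "periodic_H1 (\<lambda>x. (\<Sum>i<m. b i * F (2 ^ i * T) x, \<Sum>i<m. b i *\<^sub>R G (2 ^ i * T) x))"
  using periodic_H1_sum[of "{..<m}" "\<lambda>i x. (F (2 ^ i * T) x, G (2 ^ i * T) x)" b] assms
  by (simp add: reg_periodic_H1 sum_prod)

lemma comb_mean:
  assumes "T > 0"
  shows "(LINT x|lborelQ. (\<Sum>i<m. b i * F (2 ^ i * T) x)) = 0"
proof -
  have pos: "2 ^ i * T > 0" for i :: nat using assms by simp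
  have "integrable lborelQ (F (2 ^ i * T))" for i :: nat
    using sq_integrable_inner[OF sq_integrable_F[OF pos] lborelQ.sq_integrable_const[of 1]] by simp
  then show ?thesis
    by (simp add: reg_mean pos)
qed

text \<open>Induction on the number of vanishing moments, for all coefficients at once: moment 0
  removes \<xi> from the equation, and moment j of the new coefficients b i / 2^i is moment j + 1 of
  the old ones. The sum of squares of the coefficients does not grow, so it can be kept
  fixed.\<close>

lemma comb_decay:
  assumes T: "T > 0"
    and moments: "\<And>j. j < p \<Longrightarrow> (\<Sum>i<m. b i / 2 ^ (i * j)) = 0"
  shows "(LINT x|lborelQ. (\<Sum>i<m. b i * F (2 ^ i * T) x)\<^sup>2) \<le>
    real m * reg_bound TYPE('n) \<alpha> \<beta> * ((real CARD('n))\<^sup>2 / \<alpha>\<^sup>2 / T\<^sup>2) ^ p * (\<Sum>i<m. (b i)\<^sup>2)"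
  using moments
proof (induction p arbitrary: b)
  case 0
  then show ?case using comb_base[OF T] by simp
next
  case (Suc p)
  let ?b = "\<lambda>i. b i / 2 ^ i"
  let ?K = "(real CARD('n))\<^sup>2 / \<alpha>\<^sup>2 / T\<^sup>2"
  let ?z = "\<lambda>x. \<Sum>i<m. ?b i * F (2 ^ i * T) x"
  let ?W = "\<lambda>x. (\<Sum>i<m. b i * F (2 ^ i * T) x, \<Sum>i<m. b i *\<^sub>R G (2 ^ i * T) x)"
  have "(\<Sum>i<m. ?b i / 2 ^ (i * j)) = 0" if "j < p" for j
    using Suc.prems[of "Suc j"] that by (simp add: power_add mult_ac)
  note IH = Suc.IH[OF this]
  have z: "sq_integrable lborelQ ?z"
    using sq_integrable_fst[OF periodic_H1_sq_integrable[OF comb_periodic_H1[OF T, of ?b m]]] by simp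
  have "(\<Sum>i<m. b i) = 0" using Suc.prems[of 0] by simp
  then have "(LINT x|lborelQ. snd (?W x) \<bullet> (A x *v snd (?W x))) = - (LINT x|lborelQ. fst (?W x) * ?z x) / T"
    using comb_weak[OF T comb_periodic_H1[OF T], of b m] by simp
  from energy_estimate(2)[OF comb_periodic_H1[OF T] _ z this]
  have "(LINT x|lborelQ. (\<Sum>i<m. b i * F (2 ^ i * T) x)\<^sup>2) \<le> ?K * (LINT x|lborelQ. (?z x)\<^sup>2)"
    by (simp add: comb_mean[OF T])
  also have "\<dots> \<le> ?K * (real m * reg_bound TYPE('n) \<alpha> \<beta> * ?K ^ p * (\<Sum>i<m. (?b i)\<^sup>2))"
    by (intro mult_left_mono IH) auto
  also have "\<dots> \<le> ?K * (real m * reg_bound TYPE('n) \<alpha> \<beta> * ?K ^ p * (\<Sum>i<m. (b i)\<^sup>2))"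
  proof (intro mult_left_mono sum_mono)
    fix i
    have "(1::real) \<le> (2 ^ i)\<^sup>2" by simp
    then show "(?b i)\<^sup>2 \<le> (b i)\<^sup>2"
      using mult_left_mono[of 1 "(2 ^ i)\<^sup>2" "(b i)\<^sup>2"] by (simp add: power_divide divide_le_eq)
  qed (auto simp: reg_bound_nonneg)
  finally show ?case by (simp add: mult_ac)
qed

text \<open>The error solves an equation of the same kind as a combination with vanishing
  coefficient sum, with right-hand side -z / T. One energy estimate gives T^-2, and
  \<open>comb_decay\<close> for z gives T^(-2 (k - 1)).\<close>

lemma corrector_error:
  assumes T: "T > 0" and k: "k \<ge> 1" and g: "H1per \<phi> g" "corrector_eq A \<xi> g"
    and sum1: "(\<Sum>i<m. a i) = 1"
    and moments: "\<And>j. 1 \<le> j \<Longrightarrow> j < k \<Longrightarrow> (\<Sum>i<m. a i / 2 ^ (i * j)) = 0"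
  defines "E \<equiv> \<lambda>x. (\<Sum>i<m. a i * F (2 ^ i * T) x) - \<phi> x"
    and "e \<equiv> \<lambda>x. (\<Sum>i<m. a i *\<^sub>R G (2 ^ i * T) x) - g x"
  shows "periodic_H1 (\<lambda>x. (E x, e x))"
    and "(LINT x|lborelQ. (norm (e x))\<^sup>2) \<le>
      real CARD('n) / \<alpha>\<^sup>2 * (real m * reg_bound TYPE('n) \<alpha> \<beta> * ((real CARD('n))\<^sup>2 / \<alpha>\<^sup>2) ^ (k - 1) * (\<Sum>i<m. (a i)\<^sup>2))
        / T ^ (2 * k)"
proof -
  let ?b = "\<lambda>i. a i / 2 ^ i"
  let ?K = "(real CARD('n))\<^sup>2 / \<alpha>\<^sup>2"
  let ?z = "\<lambda>x. \<Sum>i<m. ?b i * F (2 ^ i * T) x"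
  let ?W = "\<lambda>x. (\<Sum>i<m. a i * F (2 ^ i * T) x, \<Sum>i<m. a i *\<^sub>R G (2 ^ i * T) x)"
  have H: "H1_closure (\<lambda>v. (LINT x:cubeQ|lborel. v x) = 0) \<phi> g"
    using g(1) by (simp add: H1per_def)
  note pg = H1_closure_periodic_H1[OF H] and pW = comb_periodic_H1[OF T, of a m]
  have pW': "periodic_H1 (\<lambda>x. (E x, e x))"
    using periodic_H1_lincomb[OF pW pg, of 1 "-1"] by (simp add: E_def e_def)
  then show "periodic_H1 (\<lambda>x. (E x, e x))" .
  have sqW: "sq_integrable lborelQ (\<lambda>x. \<Sum>i<m. a i * F (2 ^ i * T) x)"
    "sq_integrable lborelQ (\<lambda>x. \<Sum>i<m. a i *\<^sub>R G (2 ^ i * T) x)"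
    using sq_integrable_fst[OF periodic_H1_sq_integrable[OF pW]] sq_integrable_snd[OF periodic_H1_sq_integrable[OF pW]]
    by auto
  have sqg: "sq_integrable lborelQ \<phi>" "sq_integrable lborelQ g"
    using sq_integrable_fst[OF periodic_H1_sq_integrable[OF pg]] sq_integrable_snd[OF periodic_H1_sq_integrable[OF pg]]
    by auto
  have sqe: "sq_integrable lborelQ e"
    using sq_integrable_snd[OF periodic_H1_sq_integrable[OF pW']] by simp
  have z: "sq_integrable lborelQ ?z"
    using sq_integrable_fst[OF periodic_H1_sq_integrable[OF comb_periodic_H1[OF T, of ?b m]]] by simp
  have int: "integrable lborelQ f" if "sq_integrable lborelQ f" for f :: "real^'n \<Rightarrow> real"
    using sq_integrable_inner[OF that lborelQ.sq_integrable_const[of 1]] by simp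
  have mean: "(LINT x|lborelQ. E x) = 0"
    unfolding E_def using int[OF sqW(1)] int[OF sqg(1)] comb_mean[OF T, of a m] H1per_mean_zero[OF g(1)]
    by (subst Bochner_Integration.integral_diff) auto
  have "(LINT x|lborelQ. e x \<bullet> (A x *v (\<xi> + g x))) = 0"
    using corrector_weak[OF H g(2) pW'] by simp
  then have "(LINT x|lborelQ. e x \<bullet> (A x *v g x)) = - (LINT x|lborelQ. e x \<bullet> (A x *v \<xi>))"
    using flux_add[OF sqe lborelQ.sq_integrable_const[of \<xi>] sqg(2)] by simp
  moreover have "(LINT x|lborelQ. e x \<bullet> (A x *v e x)) =
    (LINT x|lborelQ. e x \<bullet> (A x *v (\<Sum>i<m. a i *\<^sub>R G (2 ^ i * T) x))) - (LINT x|lborelQ. e x \<bullet> (A x *v g x))"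
    unfolding e_def by (rule flux_diff[OF sqe[unfolded e_def] sqW(2) sqg(2)])
  \<comment> \<open>As the \<open>a i\<close> sum to one, the \<xi> term of the combination cancels
    exactly against that of the corrector.\<close>
  ultimately have "(LINT x|lborelQ. e x \<bullet> (A x *v e x)) = - (LINT x|lborelQ. E x * ?z x) / T"
    using comb_weak[OF T pW', of a m] by (simp add: sum1)
  with energy_estimate(1)[OF pW' _ z, of T] mean
  have "(LINT x|lborelQ. (norm (e x))\<^sup>2) \<le> real CARD('n) / \<alpha>\<^sup>2 / T\<^sup>2 * (LINT x|lborelQ. (?z x)\<^sup>2)"
    by simp
  also have "\<dots> \<le> real CARD('n) / \<alpha>\<^sup>2 / T\<^sup>2 * (real m * reg_bound TYPE('n) \<alpha> \<beta> * (?K / T\<^sup>2) ^ (k - 1) * (\<Sum>i<m. (?b i)\<^sup>2))"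
  proof (intro mult_left_mono comb_decay T)
    \<comment> \<open>Dividing by 2^i raises the order of the moment by one, so moments 1 to k - 1
      of \<open>a\<close> become moments 0 to k - 2.\<close>
    fix j assume "j < k - 1"
    then show "(\<Sum>i<m. ?b i / 2 ^ (i * j)) = 0"
      using moments[of "Suc j"] by (simp add: power_add mult_ac)
  qed simp
  also have "\<dots> \<le> real CARD('n) / \<alpha>\<^sup>2 / T\<^sup>2 * (real m * reg_bound TYPE('n) \<alpha> \<beta> * (?K / T\<^sup>2) ^ (k - 1) * (\<Sum>i<m. (a i)\<^sup>2))"
  proof (intro mult_left_mono sum_mono)
    fix i
    have "(1::real) \<le> (2 ^ i)\<^sup>2" by simp
    then show "(?b i)\<^sup>2 \<le> (a i)\<^sup>2"
      using mult_left_mono[of 1 "(2 ^ i)\<^sup>2" "(a i)\<^sup>2"] by (simp add: power_divide divide_le_eq)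
  qed (auto simp: reg_bound_nonneg)
  also have "\<dots> = real CARD('n) / \<alpha>\<^sup>2 * (real m * reg_bound TYPE('n) \<alpha> \<beta> * ?K ^ (k - 1) * (\<Sum>i<m. (a i)\<^sup>2)) / (T\<^sup>2 * (T\<^sup>2) ^ (k - 1))"
    by (simp add: power_divide power_mult_distrib)
  also have "T\<^sup>2 * (T\<^sup>2) ^ (k - 1) = T ^ (2 * k)"
    using k by (simp add: power_mult power_Suc[symmetric] del: power_Suc)
  finally show "(LINT x|lborelQ. (norm (e x))\<^sup>2) \<le>
      real CARD('n) / \<alpha>\<^sup>2 * (real m * reg_bound TYPE('n) \<alpha> \<beta> * ?K ^ (k - 1) * (\<Sum>i<m. (a i)\<^sup>2)) / T ^ (2 * k)" .
qed

end

section \<open>Richardson extrapolation\<close>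

text \<open>Passing from k to k + 1 multiplies moment j by (2^(k - j) - 1) / (2^k - 1) for j \<le>
  k. This is 1 for j = 0 and 0 for j = k, while moments that vanish already stay zero. The
  coefficients depend neither on the family nor on T, as uniform constants require.\<close>

lemma rich_coefficients:
  assumes "k \<ge> 1"
  shows "\<exists>m a. (\<forall>(F :: real \<Rightarrow> 'x \<Rightarrow> 'a::real_vector) T x. rich F k T x = (\<Sum>i<m. a i *\<^sub>R F (2 ^ i * T) x)) \<and>
    (\<Sum>i<m. a i) = (1::real) \<and> (\<forall>j. 1 \<le> j \<longrightarrow> j < k \<longrightarrow> (\<Sum>i<m. a i / 2 ^ (i * j)) = 0)"
  using assms
proof (induction k rule: dec_induct)
  case base
  show ?case by (intro exI[of _ 1] exI[of _ "\<lambda>_. 1"]) auto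
next
  case (step k)
  then obtain m a where rich: "\<And>(F :: real \<Rightarrow> 'x \<Rightarrow> 'a) T x. rich F k T x = (\<Sum>i<m. a i *\<^sub>R F (2 ^ i * T) x)"
    and sum1: "(\<Sum>i<m. a i) = (1::real)"
    and mom: "\<And>j. 1 \<le> j \<Longrightarrow> j < k \<Longrightarrow> (\<Sum>i<m. a i / 2 ^ (i * j)) = 0"
    by blast
  \<comment> \<open>Replacing T by 2 T moves the coefficient of 2^i T to index i + 1; both sequences
    are padded by zero to the common length m + 1.\<close>
  define b where "b i = (2 ^ k * (case i of 0 \<Rightarrow> 0 | Suc l \<Rightarrow> a l) - (if i < m then a i else 0)) / (2 ^ k - 1)" for i
  have k2: "(2::real) ^ k - 1 \<noteq> 0"
    using step.hyps power_gt1_lemma[of "2::real" "k - 1"] by (cases k) auto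
  \<comment> \<open>Stated for arbitrary \<open>f\<close> so that it yields the representation, the
    total sum and the moments alike.\<close>
  have sum_b: "(\<Sum>i<Suc m. b i *\<^sub>R f i) =
    (1 / (2 ^ k - 1)) *\<^sub>R ((2 ^ k) *\<^sub>R (\<Sum>i<m. a i *\<^sub>R f (Suc i)) - (\<Sum>i<m. a i *\<^sub>R f i))"
    for f :: "nat \<Rightarrow> 'b::real_vector"
  proof -
    have 1: "(\<Sum>i<Suc m. (case i of 0 \<Rightarrow> 0 | Suc l \<Rightarrow> a l) *\<^sub>R f i) = (\<Sum>i<m. a i *\<^sub>R f (Suc i))"
      by (simp add: sum.lessThan_Suc_shift del: sum.lessThan_Suc)
    have 2: "(\<Sum>i<Suc m. (if i < m then a i else 0) *\<^sub>R f i) = (\<Sum>i<m. a i *\<^sub>R f i)"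
      by simp
    have "(\<Sum>i<Suc m. b i *\<^sub>R f i) = (\<Sum>i<Suc m. (1 / (2 ^ k - 1)) *\<^sub>R
       ((2 ^ k) *\<^sub>R ((case i of 0 \<Rightarrow> 0 | Suc l \<Rightarrow> a l) *\<^sub>R f i) - (if i < m then a i else 0) *\<^sub>R f i))"
      by (intro sum.cong) (auto simp: b_def diff_divide_distrib scaleR_diff_left scaleR_diff_right)
    then show ?thesis
      unfolding scaleR_sum_right[symmetric] sum_subtractf 1 2 .
  qed
  show ?case
  proof (intro exI[of _ "Suc m"] exI[of _ b] conjI allI impI)
    fix F :: "real \<Rightarrow> 'x \<Rightarrow> 'a" and T x
    show "rich F (Suc k) T x = (\<Sum>i<Suc m. b i *\<^sub>R F (2 ^ i * T) x)"
      using step.hyps unfolding sum_b by (simp add: rich mult_ac)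
  next
    show "(\<Sum>i<Suc m. b i) = 1"
      using sum_b[of "\<lambda>_. 1::real"] k2 by (simp add: sum1)
  next
    fix j assume j: "1 \<le> j" "j < Suc k"
    have "(\<Sum>i<Suc m. b i / 2 ^ (i * j)) =
      (1 / (2 ^ k - 1)) * (2 ^ k * (\<Sum>i<m. a i / 2 ^ (Suc i * j)) - (\<Sum>i<m. a i / 2 ^ (i * j)))"
      using sum_b[of "\<lambda>i. 1 / 2 ^ (i * j) :: real"] by simp
    also have "(\<Sum>i<m. a i / 2 ^ (Suc i * j)) = (\<Sum>i<m. a i / 2 ^ (i * j)) / 2 ^ j"
      by (simp add: sum_divide_distrib power_add mult_ac)
    also have "(1 / (2 ^ k - 1)) * (2 ^ k * ((\<Sum>i<m. a i / 2 ^ (i * j)) / 2 ^ j) - (\<Sum>i<m. a i / 2 ^ (i * j))) = 0"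
      using mom[of j] j by (cases "j = k") auto
    finally show "(\<Sum>i<Suc m. b i / 2 ^ (i * j)) = 0" .
  qed
qed

text \<open>The bound on the matrices is expressed through the entries \<xi>' . (...) \<xi>; as
  \<open>C\<close> is chosen before the unit vectors, it bounds the operator norm.\<close>

theorem theorem2p3:
  fixes \<alpha> \<beta> :: real and k :: nat
  assumes "CARD('n) \<ge> 2" and "0 < \<alpha>" and "\<alpha> \<le> \<beta>" and "k \<ge> 1"
  shows "\<exists>C. \<forall>(A :: real^'n \<Rightarrow> real^'n^'n) (\<xi> :: real^'n) \<xi>' \<phi> g \<phi>' g' F G F' G' T.
     coeff_field \<alpha> \<beta> A \<and> norm \<xi> = 1 \<and> norm \<xi>' = 1 \<and>
     H1per \<phi> g \<and> corrector_eq A \<xi> g \<and>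
     H1per \<phi>' g' \<and> corrector_eq (\<lambda>x. transpose (A x)) \<xi>' g' \<and>
     (\<forall>S>0. H1per_loc (F S) (G S) \<and> reg_corrector_eq A \<xi> S (F S) (G S)) \<and>
     (\<forall>S>0. H1per_loc (F' S) (G' S) \<and> reg_corrector_eq (\<lambda>x. transpose (A x)) \<xi>' S (F' S) (G' S)) \<and>
     T > 0
     \<longrightarrow> L2Q (\<lambda>x. rich G k T x - g x) + L2Q (\<lambda>x. rich G' k T x - g' x) \<le> C / T ^ k \<and>
         \<bar>bilin_avg A \<xi>' g' \<xi> g - bilin_avg A \<xi>' (rich G' k T) \<xi> (rich G k T)\<bar> \<le> C / T ^ (2 * k)"
proof -
  let ?V = "measure lborel (cubeQ :: (real^'n) set)"
  obtain m a where
      rich': "\<forall>(G :: real \<Rightarrow> real^'n \<Rightarrow> real^'n) T x. rich G k T x = (\<Sum>i<m. a i *\<^sub>R G (2 ^ i * T) x)"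
    and sum1: "(\<Sum>i<m. a i) = (1::real)"
    and moments': "\<forall>j. 1 \<le> j \<longrightarrow> j < k \<longrightarrow> (\<Sum>i<m. a i / 2 ^ (i * j)) = 0"
    using rich_coefficients[OF assms(4), where 'x="real^'n" and 'a="real^'n"] by (elim exE conjE)
  note rich = rich'[rule_format] and moments = moments'[rule_format]
  \<comment> \<open>The bound of \<open>corrector_error\<close> on T^(2k) times the squared error;
    it is the same for the transposed field, which has the same \<alpha> and \<beta>.\<close>
  define D where "D = real CARD('n) / \<alpha>\<^sup>2 *
    (real m * reg_bound TYPE('n) \<alpha> \<beta> * ((real CARD('n))\<^sup>2 / \<alpha>\<^sup>2) ^ (k - 1) * (\<Sum>i<m. (a i)\<^sup>2))"
  have D: "D \<ge> 0"
    unfolding D_def by (simp add: reg_bound_nonneg sum_nonneg)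
  have \<beta>: "\<beta> > 0" using assms by simp
  \<comment> \<open>One summand for each claim: two gradient errors of size sqrt D / T^k, and the
    averaged product of both errors.\<close>
  define C where "C = 2 * sqrt D + \<beta> * D / ?V"
  have C: "2 * sqrt D \<le> C" "\<beta> * D / ?V \<le> C"
    using D \<beta> measure_cubeQ_pos[where 'n='n] by (auto simp: C_def)
  show ?thesis
  proof (intro exI[of _ C] allI impI, elim conjE)
    fix A :: "real^'n \<Rightarrow> real^'n^'n" and \<xi> \<xi>' :: "real^'n" and \<phi> g \<phi>' g' F G F' G' and T :: real
    assume A: "coeff_field \<alpha> \<beta> A" and unit: "norm \<xi> = 1" "norm \<xi>' = 1"
      and g: "H1per \<phi> g" "corrector_eq A \<xi> g"
      and g': "H1per \<phi>' g'" "corrector_eq (\<lambda>x. transpose (A x)) \<xi>' g'"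
      and G: "\<forall>S>0. H1per_loc (F S) (G S) \<and> reg_corrector_eq A \<xi> S (F S) (G S)"
      and G': "\<forall>S>0. H1per_loc (F' S) (G' S) \<and> reg_corrector_eq (\<lambda>x. transpose (A x)) \<xi>' S (F' S) (G' S)"
      and T: "T > 0"
    interpret elliptic \<alpha> \<beta> A
      using A assms(2) by unfold_locales
    interpret E': elliptic \<alpha> \<beta> "\<lambda>x. transpose (A x)"
      by (rule elliptic_transpose)
    interpret R: reg_family \<alpha> \<beta> A \<xi> F G
      using unit G by unfold_locales auto
    interpret R': reg_family \<alpha> \<beta> "\<lambda>x. transpose (A x)" \<xi>' F' G'
      using unit G' by unfold_locales auto
    define e where "e x = rich G k T x - g x" for x
    define e' where "e' x = rich G' k T x - g' x" for x
    have pe: "periodic_H1 (\<lambda>x. ((\<Sum>i<m. a i * F (2 ^ i * T) x) - \<phi> x, e x))"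
      unfolding e_def rich by (rule R.corrector_error(1)[OF T assms(4) g sum1 moments])
    have pe': "periodic_H1 (\<lambda>x. ((\<Sum>i<m. a i * F' (2 ^ i * T) x) - \<phi>' x, e' x))"
      unfolding e'_def rich by (rule R'.corrector_error(1)[OF T assms(4) g' sum1 moments])
    have e: "(LINT x|lborelQ. (norm (e x))\<^sup>2) \<le> D / T ^ (2 * k)"
      using R.corrector_error(2)[OF T assms(4) g sum1 moments] unfolding e_def rich D_def .
    have e': "(LINT x|lborelQ. (norm (e' x))\<^sup>2) \<le> D / T ^ (2 * k)"
      using R'.corrector_error(2)[OF T assms(4) g' sum1 moments] unfolding e'_def rich D_def .
    have L2Q: "L2Q h = sqrt (LINT x|lborelQ. (norm (h x))\<^sup>2)" for h :: "real^'n \<Rightarrow> real^'n"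
      by (simp add: L2Q_def integral_restrict_space set_lebesgue_integral_def)
    have "sqrt (D / T ^ (2 * k)) = sqrt D / T ^ k"
      using T by (simp add: real_sqrt_divide power_mult real_sqrt_power)
    then have "L2Q e \<le> sqrt D / T ^ k" "L2Q e' \<le> sqrt D / T ^ k"
      using real_sqrt_le_mono[OF e] real_sqrt_le_mono[OF e'] by (simp_all add: L2Q)
    moreover have "2 * sqrt D / T ^ k \<le> C / T ^ k"
      using C T by (intro divide_right_mono) auto
    ultimately have 1: "L2Q (\<lambda>x. rich G k T x - g x) + L2Q (\<lambda>x. rich G' k T x - g' x) \<le> C / T ^ k"
      by (simp add: e_def[abs_def] e'_def[abs_def])
    have H: "H1_closure (\<lambda>v. (LINT x:cubeQ|lborel. v x) = 0) \<phi> g"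
      "H1_closure (\<lambda>v. (LINT x:cubeQ|lborel. v x) = 0) \<phi>' g'"
      using g g' by (simp_all add: H1per_def)
    have sqe: "sq_integrable lborelQ e" "sq_integrable lborelQ e'"
      using sq_integrable_snd[OF periodic_H1_sq_integrable[OF pe]] sq_integrable_snd[OF periodic_H1_sq_integrable[OF pe']]
      by auto
    have "sq_integrable lborelQ g" "sq_integrable lborelQ g'"
      using H[THEN H1_closure_periodic_H1, THEN periodic_H1_sq_integrable, THEN sq_integrable_snd] by auto
    then have sqg: "sq_integrable lborelQ (\<lambda>x. \<xi> + g x)" "sq_integrable lborelQ (\<lambda>x. \<xi>' + g' x)"
      by (auto intro: sq_integrable_add lborelQ.sq_integrable_const)
    \<comment> \<open>The two cross terms vanish: the dual error is a test function for the
      corrector equation and, after transposition, the primal error is one for the dual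
      equation.\<close>
    have z1: "(LINT x|lborelQ. e' x \<bullet> (A x *v (\<xi> + g x))) = 0"
      using corrector_weak[OF H(1) g(2) pe'] by simp
    have "(\<xi>' + g' x) \<bullet> (A x *v e x) = e x \<bullet> (transpose (A x) *v (\<xi>' + g' x))" for x
      by (metis dot_lmul_matrix inner_commute transpose_matrix_vector)
    then have z2: "(LINT x|lborelQ. (\<xi>' + g' x) \<bullet> (A x *v e x)) = 0"
      using E'.corrector_weak[OF H(2) g'(2) pe] by simp
    have avg: "bilin_avg A \<xi>' h' \<xi> h = (LINT x|lborelQ. (\<xi>' + h' x) \<bullet> (A x *v (\<xi> + h x))) / ?V" for h h'
      by (simp add: bilin_avg_def integral_restrict_space set_lebesgue_integral_def)
    have "(LINT x|lborelQ. (\<xi>' + rich G' k T x) \<bullet> (A x *v (\<xi> + rich G k T x))) =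
      (LINT x|lborelQ. ((\<xi>' + g' x) + e' x) \<bullet> (A x *v ((\<xi> + g x) + e x)))"
      by (simp add: e_def e'_def algebra_simps)
    also have "\<dots> = (LINT x|lborelQ. (\<xi>' + g' x) \<bullet> (A x *v (\<xi> + g x)) + (\<xi>' + g' x) \<bullet> (A x *v e x) +
        e' x \<bullet> (A x *v (\<xi> + g x)) + e' x \<bullet> (A x *v e x))"
      by (intro Bochner_Integration.integral_cong)
        (auto simp: matrix_vector_right_distrib inner_add_left inner_add_right)
    also have "\<dots> = (LINT x|lborelQ. (\<xi>' + g' x) \<bullet> (A x *v (\<xi> + g x))) + (LINT x|lborelQ. e' x \<bullet> (A x *v e x))"
      using sq_integrable_inner[OF sqg(2) sq_integrable_flux[OF sqg(1)]]
        sq_integrable_inner[OF sqg(2) sq_integrable_flux[OF sqe(1)]]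
        sq_integrable_inner[OF sqe(2) sq_integrable_flux[OF sqg(1)]]
        sq_integrable_inner[OF sqe(2) sq_integrable_flux[OF sqe(1)]]
      by (simp add: z1 z2)
    finally have "\<bar>bilin_avg A \<xi>' g' \<xi> g - bilin_avg A \<xi>' (rich G' k T) \<xi> (rich G k T)\<bar> =
      \<bar>LINT x|lborelQ. e' x \<bullet> (A x *v e x)\<bar> / ?V"
      by (simp add: avg add_divide_distrib)
    also have "\<bar>LINT x|lborelQ. e' x \<bullet> (A x *v e x)\<bar> \<le> \<beta> * (D / T ^ (2 * k))"
    proof (rule power2_le_imp_le)
      \<comment> \<open>Only the product of the two errors is left, and each of them contributes
        T^-k to its bound.\<close>
      have "(LINT x|lborelQ. e' x \<bullet> (A x *v e x))\<^sup>2 \<le> (D / T ^ (2 * k)) * (\<beta>\<^sup>2 * (D / T ^ (2 * k)))"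
        using D T by (intro order_trans[OF flux_bound[OF sqe(2,1)]] mult_mono e e') auto
      then show "\<bar>LINT x|lborelQ. e' x \<bullet> (A x *v e x)\<bar>\<^sup>2 \<le> (\<beta> * (D / T ^ (2 * k)))\<^sup>2"
        by (simp add: power2_eq_square mult_ac)
    qed (use D \<beta> T in simp)
    also have "\<beta> * (D / T ^ (2 * k)) / ?V = (\<beta> * D / ?V) / T ^ (2 * k)" by simp
    also have "\<dots> \<le> C / T ^ (2 * k)"
      using C T by (intro divide_right_mono) auto
    finally have "\<bar>bilin_avg A \<xi>' g' \<xi> g - bilin_avg A \<xi>' (rich G' k T) \<xi> (rich G k T)\<bar> \<le> C / T ^ (2 * k)"
      using measure_cubeQ_pos[where 'n='n] by (simp add: divide_right_mono)
    with 1 show "L2Q (\<lambda>x. rich G k T x - g x) + L2Q (\<lambda>x. rich G' k T x - g' x) \<le> C / T ^ k \<and>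
         \<bar>bilin_avg A \<xi>' g' \<xi> g - bilin_avg A \<xi>' (rich G' k T) \<xi> (rich G k T)\<bar> \<le> C / T ^ (2 * k)"
      by simp
  qed
qed

end
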